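(* Let $K_1$ and $K_2$ be two intermediate fields of a purely inseparable extension $\Omega/k$. Then: (i) $di(K_1(K_2)/k)\le di(K_1/k)+di(K_2/k)$, with equality if $K_1$ and $K_2$ are $k$-linearly disjoint. (ii) $di(K_1(K_2)/K_2)\le di(K_1/k)$, with equality if $K_1$ and $K_2$ are $k$-linearly disjoint.
   Context: All fields are commutative of characteristic $p>0$. $K_1(K_2)$ is the compositum of $K_1$ and $K_2$ in $\Omega$. A subset $B\subseteq K$ is an $r$-base of an extension $K/k$ if $K=k(K^p)(B)$ and, for every $x\in B$, $x\notin k(K^p)(B\setminus\{x\})$; every extension has an $r$-base and all $r$-bases of a given extension have the same cardinality. For a purely inseparable extension $K/k$ and $n\ge 1$, put $k_n=k^{p^{-n}}\cap K=\{x\in K: x^{p^n}\in k\}$ and let $B_n$ be an $r$-base of $k_n/k$. The degree of irrationality of $K/k$ is the cardinal $di(K/k)=\sup_{n\ge 1}|B_n|$ (supremum of cardinals). *)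

theory Defs
  imports "HOL-Algebra.Algebra"
begin

text \<open>
  Every field occurring below is a subfield of one ambient field \<open>R\<close>; an extension \<open>K/k\<close> is given
  by two subfields \<open>k \<subseteq> K\<close> of \<open>R\<close>, in the argument order \<open>K k\<close>. The parameter \<open>p\<close> is the
  characteristic of \<open>R\<close>.
\<close>

text \<open>The additive order of the unit; \<open>group.ord\<close> is \<open>0\<close> for elements of infinite order.\<close>
definition characteristic :: "('a, 'b) ring_scheme \<Rightarrow> nat" where
  "characteristic R = group.ord (add_monoid R) \<one>\<^bsub>R\<^esub>"

definition purely_inseparable ::
    "('a, 'b) ring_scheme \<Rightarrow> nat \<Rightarrow> 'a set \<Rightarrow> 'a set \<Rightarrow> bool" where
  "purely_inseparable R p K k \<longleftrightarrow>
     subfield K R \<and> subfield k R \<and> k \<subseteq> K \<and> (\<forall>x\<in>K. \<exists>n::nat. x [^]\<^bsub>R\<^esub> (p ^ n) \<in> k)"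

definition compositum :: "('a, 'b) ring_scheme \<Rightarrow> 'a set \<Rightarrow> 'a set \<Rightarrow> 'a set" where
  "compositum R K L = generate_field R (K \<union> L)"

text \<open>A list is \<open>k\<close>-independent in the sense of \<open>ring.independent\<close> iff it is repetition-free and
  its elements are linearly independent over \<open>k\<close>, so lists range over the finite families.\<close>
definition linearly_disjoint ::
    "('a, 'b) ring_scheme \<Rightarrow> 'a set \<Rightarrow> 'a set \<Rightarrow> 'a set \<Rightarrow> bool" where
  "linearly_disjoint R k K L \<longleftrightarrow>
     (\<forall>Us. set Us \<subseteq> K \<longrightarrow> ring.independent R k Us \<longrightarrow> ring.independent R L Us)"

definition r_span :: "('a, 'b) ring_scheme \<Rightarrow> nat \<Rightarrow> 'a set \<Rightarrow> 'a set \<Rightarrow> 'a set \<Rightarrow> 'a set" where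
  "r_span R p K k B = generate_field R (k \<union> (\<lambda>x. x [^]\<^bsub>R\<^esub> p) ` K \<union> B)"

definition r_base :: "('a, 'b) ring_scheme \<Rightarrow> nat \<Rightarrow> 'a set \<Rightarrow> 'a set \<Rightarrow> 'a set \<Rightarrow> bool" where
  "r_base R p K k B \<longleftrightarrow>
     B \<subseteq> K \<and> K = r_span R p K k B \<and> (\<forall>x\<in>B. x \<notin> r_span R p K k (B - {x}))"

definition root_field :: "('a, 'b) ring_scheme \<Rightarrow> nat \<Rightarrow> 'a set \<Rightarrow> 'a set \<Rightarrow> nat \<Rightarrow> 'a set" where
  "root_field R p K k n = {x \<in> K. x [^]\<^bsub>R\<^esub> (p ^ n) \<in> k}"

text \<open>Cardinals are cardinal orders, which are unique only up to \<open>=o\<close>; hence so is the supremum.\<close>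
definition card_Sup :: "'a rel set \<Rightarrow> 'a rel" where
  "card_Sup S = (SOME r. Card_order r \<and> (\<forall>s\<in>S. s \<le>o r) \<and>
     (\<forall>t :: 'a rel. Card_order t \<longrightarrow> (\<forall>s\<in>S. s \<le>o t) \<longrightarrow> r \<le>o t))"

lemma card_Sup:
  fixes S :: "'a rel set"
  assumes "\<forall>s\<in>S. Card_order s"
  shows "Card_order (card_Sup S)"
    and "\<And>s. s \<in> S \<Longrightarrow> s \<le>o card_Sup S"
    and "\<And>t :: 'b rel. Card_order t \<Longrightarrow> \<forall>s\<in>S. s \<le>o t \<Longrightarrow> card_Sup S \<le>o t"
proof -
  have S_le: "r \<le>o |UNIV :: 'a set|" if "Card_order r" for r :: "'a rel"
    using that by (meson card_of_Field_ordIso card_of_UNIV ordIso_ordLeq_trans ordIso_symmetric)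
  let ?U = "{t :: 'a rel. Card_order t \<and> (\<forall>s\<in>S. s \<le>o t)}"
  have "|UNIV :: 'a set| \<in> ?U"
    using assms S_le by auto
  then have "?U \<noteq> {}" by blast
  then have "\<exists>r\<in>?U. \<forall>r'\<in>?U. r \<le>o r'"
    by (intro exists_minim_Card_order) auto
  then obtain r where r: "r \<in> ?U" "\<forall>r'\<in>?U. r \<le>o r'" ..
  have "Card_order r \<and> (\<forall>s\<in>S. s \<le>o r) \<and>
     (\<forall>t :: 'a rel. Card_order t \<longrightarrow> (\<forall>s\<in>S. s \<le>o t) \<longrightarrow> r \<le>o t)"
    using r by simp
  then have "\<exists>r :: 'a rel. Card_order r \<and> (\<forall>s\<in>S. s \<le>o r) \<and>
     (\<forall>t :: 'a rel. Card_order t \<longrightarrow> (\<forall>s\<in>S. s \<le>o t) \<longrightarrow> r \<le>o t)"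
    by (rule exI)
  from someI_ex[OF this]
  have *: "Card_order (card_Sup S)" "\<forall>s\<in>S. s \<le>o card_Sup S"
    "\<And>t :: 'a rel. Card_order t \<Longrightarrow> \<forall>s\<in>S. s \<le>o t \<Longrightarrow> card_Sup S \<le>o t"
    unfolding card_Sup_def by blast+
  show "Card_order (card_Sup S)" by (fact *(1))
  show "s \<le>o card_Sup S" if "s \<in> S" for s using that *(2) by blast
  show "card_Sup S \<le>o t" if t: "Card_order t" "\<forall>s\<in>S. s \<le>o t" for t :: "'b rel"
  proof (rule ccontr)
    assume "\<not> card_Sup S \<le>o t"
    then have less: "t <o card_Sup S"
      using *(1) t(1) by (simp add: not_ordLeq_iff_ordLess card_order_on_well_order_on)
    then have "|Field t| \<le>o |UNIV :: 'a set|"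
      using t(1) *(1) S_le
      by (meson card_of_Field_ordIso ordIso_ordLeq_trans ordLess_imp_ordLeq ordLeq_transitive)
    then obtain f :: "'b \<Rightarrow> 'a" where f: "inj_on f (Field t)"
      using card_of_ordLeq[of "Field t" "UNIV :: 'a set"] by blast
    have iso: "t =o |f ` Field t|"
      using card_of_Field_ordIso[OF t(1)] card_of_ordIsoI[OF inj_on_imp_bij_betw[OF f]]
      by (meson ordIso_symmetric ordIso_transitive)
    then have "card_Sup S \<le>o |f ` Field t|"
      using *(3)[of "|f ` Field t|"] t(2) by (meson card_of_Card_order ordLeq_ordIso_trans)
    then show False
      using iso less by (meson not_ordLess_ordLeq ordIso_symmetric ordLeq_ordIso_trans)
  qed
qed

text \<open>Since all \<open>r\<close>-bases of an extension have the same cardinality, the choice of the base of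
  each \<open>k\<^sub>n/k\<close> does not matter.\<close>
definition di :: "('a, 'b) ring_scheme \<Rightarrow> nat \<Rightarrow> 'a set \<Rightarrow> 'a set \<Rightarrow> 'a rel" where
  "di R p K k = card_Sup {|SOME B. r_base R p (root_field R p K k n) k B| | n. 1 \<le> n}"

end

theory Submission
  imports Defs
begin

text \<open>
  Call a subset \<open>B\<close> of \<open>\<Omega>\<close> irredundant over \<open>k\<close> if no \<open>b \<in> B\<close> lies in \<open>k(B - {b})\<close>. Over a purely
  inseparable extension of bounded exponent such as \<open>k\<^sub>n/k\<close>, the condition \<open>K = k(K\<^sup>p)(B)\<close> can be
  iterated until the \<open>p\<close>-th powers have sunk into \<open>k\<close>, so an \<open>r\<close>-base is an irredundant set with
  \<open>K = k(B)\<close> (\<open>r_base_bounded_exponent\<close>). Everything then rests on one monotonicity statement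
  (\<open>irredundant_ordLeq\<close>): if \<open>B\<close> is irredundant over \<open>k\<close> and \<open>B \<subseteq> k(C)\<close>, then \<open>|B| \<le> |C|\<close>. It
  follows that \<open>di(K/k)\<close> is the supremum of \<open>|B|\<close> over the sets \<open>B \<subseteq> k\<^sub>n\<close> that are irredundant over
  \<open>k\<close> (\<open>irredundant_ordLeq_di\<close>, \<open>di_ordLeq\<close>).

  Monotonicity is not plain exchange, since irredundance over \<open>k\<close> does not define a matroid. Over a
  subfield \<open>M\<close> containing all \<open>p\<close>-th powers exchange does hold, because \<open>x \<notin> M\<close> and \<open>x\<^sup>p \<in> M\<close> force
  \<open>[M(x) : M] = p\<close> (\<open>exchange\<close>, \<open>steinitz\<close>). For finite \<open>C\<close> the field \<open>k(C)\<close> is reached from \<open>k(B)\<close>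
  by adjoining \<open>p\<close>-th roots one at a time, and no such step \<open>K \<subseteq> K(a)\<close>, \<open>a\<^sup>p \<in> K\<close>, lowers the number
  of elements independent over \<open>k(K\<^sup>p)\<close>: either \<open>k(K(a)\<^sup>p) = k(K\<^sup>p)\<close>, or the new element \<open>a\<^sup>p\<close> of the
  base costs one independent element and \<open>a\<close> itself replaces it (\<open>rank_step\<close>). For infinite \<open>C\<close> one
  counts finite subsets.

  The two upper bounds follow by writing an irredundant \<open>B \<subseteq> K\<^sub>1(K\<^sub>2)\<close> as the increasing union of its
  intersections with the fields generated by \<open>r\<close>-bases of the \<open>n\<close>-th root fields of the factors; each
  piece is bounded by monotonicity, and a bound common to the pieces of an increasing sequence
  passes to its union, whether the bound is finite or infinite. For the equalities, linear
  disjointness gives \<open>K\<^sub>1 \<inter> K\<^sub>2(S) = k(S)\<close> for \<open>S \<subseteq> K\<^sub>1\<close>, and the same with the factors exchanged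
  (\<open>linearly_disjoint_descent\<close>, \<open>linearly_disjoint_descent_sym\<close>). Hence a subset of \<open>K\<^sub>1\<close> irredundant
  over \<open>k\<close> remains so over \<open>K\<^sub>2\<close>, and irredundant subsets of \<open>K\<^sub>1\<close> and \<open>K\<^sub>2\<close> are disjoint with
  irredundant union.
\<close>

section \<open>Cardinalities of increasing unions and sums of suprema\<close>

lemma card_of_ordLeq_iff_card:
  assumes "finite A" "finite B"
  shows "|A| \<le>o |B| \<longleftrightarrow> card A \<le> card B"
  using assms inj_on_iff_card_le[of A B] by (simp flip: card_of_ordLeq)

lemma card_of_ordLeq_if_finite_subsets:
  fixes r :: "'b rel"
  assumes r: "Card_order r" "finite (Field r)" and F: "\<And>F. finite F \<Longrightarrow> F \<subseteq> A \<Longrightarrow> |F| \<le>o r"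
  shows "|A| \<le>o r"
proof -
  have rr: "r =o |Field r|" using card_of_Field_ordIso[OF r(1)] ordIso_symmetric by blast
  have "finite A"
  proof (rule ccontr)
    assume "infinite A"
    then obtain F where F': "finite F" "card F = Suc (card (Field r))" "F \<subseteq> A"
      using infinite_arbitrarily_large by blast
    then have "|F| \<le>o |Field r|" using F rr ordLeq_ordIso_trans by blast
    then show False using card_of_ordLeq_iff_card[OF F'(1) r(2)] F'(2) by simp
  qed
  then show ?thesis using F by blast
qed

lemma finite_subset_incseq_UN:
  assumes "incseq A" "finite F" "F \<subseteq> (\<Union>n. A n)"
  obtains n where "F \<subseteq> A (n::nat)"
proof -
  have "\<exists>n. F \<subseteq> A n"
    using assms(2,3)
  proof (induction F rule: finite_induct)
    case (insert x F)
    then obtain m n where "F \<subseteq> A m" "x \<in> A n" by auto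
    then have "insert x F \<subseteq> A (max m n)"
      using incseqD[OF assms(1), of m "max m n"] incseqD[OF assms(1), of n "max m n"] by auto
    then show ?case by blast
  qed simp
  then show thesis using that by blast
qed

text \<open>
  Two different reasons: if \<open>r\<close> is infinite it absorbs the countable index set; if \<open>r\<close> is finite,
  every finite part of the union already lies in a single \<open>A n\<close>.
\<close>

lemma card_of_incseq_UN_ordLeq:
  fixes A :: "nat \<Rightarrow> 'a set" and r :: "'b rel"
  assumes r: "Card_order r" and A: "incseq A" "\<And>n. |A n| \<le>o r"
  shows "|\<Union>n. A n| \<le>o r"
proof (cases "finite (Field r)")
  case True
  show ?thesis
  proof (rule card_of_ordLeq_if_finite_subsets[OF r True])
    fix F assume F: "finite F" "F \<subseteq> (\<Union>n. A n)"
    then have "\<exists>n. F \<subseteq> A n" using finite_subset_incseq_UN[OF A(1)] by metis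
    then show "|F| \<le>o r" using A(2) card_of_mono1 ordLeq_transitive by blast
  qed
next
  case False
  then have "|UNIV :: nat set| \<le>o |Field r|" using infinite_iff_card_of_nat by blast
  then have "|UNIV :: nat set| \<le>o r" using card_of_Field_ordIso[OF r] ordLeq_ordIso_trans by blast
  then show ?thesis using False A(2) r by (intro card_of_UNION_ordLeq_infinite_Field) auto
qed

text \<open>
  A nonempty set of cardinals with a finite bound has a greatest element.
\<close>

lemma card_Sup_attained:
  fixes S :: "'a rel set" and r :: "'c rel"
  assumes S: "S \<noteq> {}" "\<forall>s\<in>S. Card_order s" and r: "Card_order r" "finite (Field r)"
    and le: "\<And>s. s \<in> S \<Longrightarrow> s \<le>o r"
  obtains s where "s \<in> S" "card_Sup S \<le>o s"
proof -
  have iso: "t =o |Field t|" if "Card_order t" for t :: "'d rel"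
    using card_of_Field_ordIso[OF that] ordIso_symmetric by blast
  have fin: "finite (Field s) \<and> card (Field s) \<le> card (Field r)" if "s \<in> S" for s
  proof -
    have "|Field s| \<le>o |Field r|"
      using le[OF that] iso[OF r(1)] card_of_Field_ordIso[of s] S(2) that
      by (meson ordIso_ordLeq_trans ordLeq_ordIso_trans)
    then show ?thesis
      using r(2) card_of_ordLeq_finite card_of_ordLeq_iff_card by blast
  qed
  obtain s where s: "s \<in> S" "\<And>t. t \<in> S \<Longrightarrow> card (Field t) \<le> card (Field s)"
    using ex_has_greatest_nat[of "\<lambda>s. s \<in> S" _ "\<lambda>s. card (Field s)" "Suc (card (Field r))"] S(1) fin
    by (metis ex_in_conv le_imp_less_Suc less_or_eq_imp_le)
  have "t \<le>o s" if "t \<in> S" for t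
  proof -
    have "|Field t| \<le>o |Field s|" using fin s that card_of_ordLeq_iff_card by blast
    then show ?thesis using iso[of t] card_of_Field_ordIso[of s] S(2) s(1) that
      by (meson ordIso_ordLeq_trans ordLeq_ordIso_trans)
  qed
  then show thesis using that[OF s(1)] card_Sup(3)[OF S(2), of s] S(2) s(1) by blast
qed

text \<open>
  For infinite \<open>r\<close> both suprema are at most \<open>r\<close>, and a sum of two such cardinals is absorbed. For
  finite \<open>r\<close> both suprema are attained, so the hypothesis applies to one particular pair.
\<close>

lemma csum_card_Sup_ordLeq:
  fixes S :: "'a rel set" and T :: "'b rel set" and r :: "'c rel"
  assumes S: "S \<noteq> {}" "\<forall>s\<in>S. Card_order s" and T: "T \<noteq> {}" "\<forall>t\<in>T. Card_order t"
    and r: "Card_order r" and le: "\<And>s t. s \<in> S \<Longrightarrow> t \<in> T \<Longrightarrow> s +c t \<le>o r"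
  shows "card_Sup S +c card_Sup T \<le>o r"
proof -
  have Sr: "s \<le>o r" if "s \<in> S" for s
    using that T le S(2) ordLeq_csum1 ordLeq_transitive by (metis ex_in_conv)
  have Tr: "t \<le>o r" if "t \<in> T" for t
    using that S le T(2) ordLeq_csum2 ordLeq_transitive by (metis ex_in_conv)
  show ?thesis
  proof (cases "finite (Field r)")
    case True
    obtain s t where "s \<in> S" "card_Sup S \<le>o s" "t \<in> T" "card_Sup T \<le>o t"
      using card_Sup_attained[OF S r True Sr] card_Sup_attained[OF T r True Tr] by metis
    then show ?thesis using le csum_mono ordLeq_transitive by blast
  next
    case False
    have "card_Sup S \<le>o r" "card_Sup T \<le>o r"
      using card_Sup(3)[OF S(2) r] card_Sup(3)[OF T(2) r] Sr Tr by blast+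
    then show ?thesis
      using False r card_Sup(1)[OF S(2)] card_Sup(1)[OF T(2)]
      by (intro csum_cinfinite_bound) (simp_all add: cinfinite_def)
  qed
qed

section \<open>The Frobenius map in prime characteristic\<close>

lemma (in cring) binomial_expansion:
  assumes a: "a \<in> carrier R" and b: "b \<in> carrier R"
  shows "(a \<oplus> b) [^] n = (\<Oplus>i\<in>{..n}. [(n choose i)] \<cdot> (a [^] i \<otimes> b [^] (n - i)))"
proof (induction n)
  case 0
  then show ?case by simp
next
  case (Suc n)
  let ?f = "\<lambda>n i. [(n choose i)] \<cdot> (a [^] i \<otimes> b [^] (n - i))"
  let ?g = "\<lambda>i. [(n choose i)] \<cdot> (a [^] i \<otimes> b [^] (Suc n - i))"
  let ?h = "\<lambda>i. [(n choose i)] \<cdot> (a [^] Suc i \<otimes> b [^] (n - i))"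
  have cl: "?f n i \<in> carrier R" "?g i \<in> carrier R" "?h i \<in> carrier R" for i n
    using a b by auto
  have fa: "?f n i \<otimes> a = ?h i" for i
    using a b by (subst add_pow_ldistr) (simp_all add: m_ac)
  have fb: "?f n i \<otimes> b = ?g i" if "i \<le> n" for i
    using a b that by (subst add_pow_ldistr) (simp_all add: m_ac Suc_diff_le)
  have "(a \<oplus> b) [^] Suc n = (\<Oplus>i\<in>{..n}. ?f n i) \<otimes> a \<oplus> (\<Oplus>i\<in>{..n}. ?f n i) \<otimes> b"
    using a b cl Suc by (simp add: r_distr)
  also have "\<dots> = (\<Oplus>i\<in>{..n}. ?h i) \<oplus> (\<Oplus>i\<in>{..n}. ?g i)"
  proof -
    have "(\<Oplus>i\<in>{..n}. ?f n i) \<otimes> a = (\<Oplus>i\<in>{..n}. ?h i)"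
      using a cl fa by (subst finsum_ldistr) (auto intro!: finsum_cong')
    moreover have "(\<Oplus>i\<in>{..n}. ?f n i) \<otimes> b = (\<Oplus>i\<in>{..n}. ?g i)"
      using b cl fb by (subst finsum_ldistr) (auto intro!: finsum_cong')
    ultimately show ?thesis by simp
  qed
  also have "(\<Oplus>i\<in>{..n}. ?g i) = (\<Oplus>i\<in>{..Suc n}. ?g i)"
    using a b cl by (simp add: binomial_eq_0)
  also have "\<dots> = (\<Oplus>i\<in>{..n}. ?g (Suc i)) \<oplus> ?g 0"
    using cl by (intro finsum_Suc2) auto
  also have "(\<Oplus>i\<in>{..n}. ?h i) \<oplus> ((\<Oplus>i\<in>{..n}. ?g (Suc i)) \<oplus> ?g 0)
      = ((\<Oplus>i\<in>{..n}. ?h i) \<oplus> (\<Oplus>i\<in>{..n}. ?g (Suc i))) \<oplus> ?g 0"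
    using a b cl by (intro a_assoc[symmetric] finsum_closed) auto
  also have "(\<Oplus>i\<in>{..n}. ?h i) \<oplus> (\<Oplus>i\<in>{..n}. ?g (Suc i))
     = (\<Oplus>i\<in>{..n}. ?h i \<oplus> ?g (Suc i))"
    using a b cl by (intro finsum_addf[symmetric]) auto
  also have "\<dots> = (\<Oplus>i\<in>{..n}. ?f (Suc n) (Suc i))"
    using a b cl by (intro finsum_cong') (auto simp: add.nat_pow_mult)
  also have "?g 0 = ?f (Suc n) 0" by simp
  also have "(\<Oplus>i\<in>{..n}. ?f (Suc n) (Suc i)) \<oplus> ?f (Suc n) 0 = (\<Oplus>i\<in>{..Suc n}. ?f (Suc n) i)"
    using a b cl by (intro finsum_Suc2[symmetric]) auto
  finally show ?case .
qed

text \<open>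
  Stated for rings because it is applied both to the field and to its polynomial ring, where it
  turns \<open>X\<^sup>p - x\<^sup>p\<close> into \<open>(X - x)\<^sup>p\<close>.
\<close>

lemma (in cring) freshmans_dream:
  assumes p: "normalization_semidom_class.prime (p::nat)" and char: "[p] \<cdot> \<one> = \<zero>"
    and a: "a \<in> carrier R" and b: "b \<in> carrier R"
  shows "(a \<oplus> b) [^] p = a [^] p \<oplus> b [^] p"
proof -
  let ?f = "\<lambda>i. [(p choose i)] \<cdot> (a [^] i \<otimes> b [^] (p - i))"
  have kill: "[(p * m)] \<cdot> z = \<zero>" if "z \<in> carrier R" for m z
  proof -
    have "[p] \<cdot> z = ([p] \<cdot> \<one>) \<otimes> z" using that by (simp add: add_pow_ldistr)
    then have "[p] \<cdot> z = \<zero>" using char that by simp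
    then show ?thesis using that by (simp flip: add.nat_pow_pow)
  qed
  obtain q where q: "p = Suc q" "q > 0" using prime_gt_1_nat[OF p] by (cases p) auto
  have z: "?f i = \<zero>" if "0 < i" "i < p" for i
  proof -
    have "p dvd (p choose i)" using that p by (intro dvd_choose_prime) auto
    then obtain m where "(p choose i) = p * m" by (auto elim: dvdE)
    then show ?thesis using kill a b by simp
  qed
  have "(a \<oplus> b) [^] p = (\<Oplus>i\<in>{..p}. ?f i)" by (rule binomial_expansion[OF a b])
  also have "\<dots> = (\<Oplus>i\<in>{0,p}. ?f i)"
    using a b z by (intro add.finprod_mono_neutral_cong_right) auto
  also have "\<dots> = a [^] p \<oplus> b [^] p"
    using a b q by (simp add: a_comm)
  finally show ?thesis .
qed

lemma (in field) prime_characteristic: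
  assumes "characteristic R = p" "p > 0"
  shows "normalization_semidom_class.prime p" and "[p] \<cdot> \<one> = \<zero>"
proof -
  have dvd: "[n] \<cdot> \<one> = \<zero> \<longleftrightarrow> p dvd n" for n :: nat
    using add.pow_eq_id[of \<one> n] assms(1) by (simp add: characteristic_def add_pow_def)
  show "[p] \<cdot> \<one> = \<zero>" using dvd by simp
  show "normalization_semidom_class.prime p"
    unfolding prime_nat_iff
  proof (intro conjI allI impI)
    have "p \<noteq> 1" using dvd[of 1] by auto
    then show "1 < p" using assms(2) by simp
    fix m assume "m dvd p"
    then obtain q where q: "p = m * q" by (rule dvdE)
    have "([m] \<cdot> \<one>) \<otimes> ([q] \<cdot> \<one>) = [m] \<cdot> ([q] \<cdot> \<one>)" by (simp add: add_pow_ldistr)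
    also have "\<dots> = [p] \<cdot> \<one>" unfolding q by (simp add: add.nat_pow_pow mult.commute)
    finally have "[m] \<cdot> \<one> = \<zero> \<or> [q] \<cdot> \<one> = \<zero>" using dvd[of p] by (simp add: integral_iff)
    then have "p dvd m \<or> p dvd q" using dvd by simp
    then show "m = 1 \<or> m = p" using q assms(2) by (auto elim!: dvdE)
  qed
qed

lemma (in field) inv_nat_pow:
  assumes "a \<in> carrier R" "a \<noteq> \<zero>"
  shows "(inv a) [^] (n::nat) = inv (a [^] n)"
proof -
  have "a \<in> Units R" using assms field_Units by simp
  then show ?thesis
    by (metis Units_closed Units_inv_closed Units_l_inv Units_r_inv comm_inv_char
        local.nat_pow_one m_comm nat_pow_closed nat_pow_distrib)
qed

lemma (in field) subfield_pow_closed: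
  assumes "subfield K R" "x \<in> K" shows "x [^] (n::nat) \<in> K"
  using assms subringE(3,6)[OF subfieldE(1)[OF assms(1)]] by (induction n) auto

locale char_p_field = field R for R (structure) +
  fixes p :: nat
  assumes prime_p: "normalization_semidom_class.prime p" and char_p: "[p] \<cdot> \<one> = \<zero>"
begin

lemma frobenius_add:
  assumes "a \<in> carrier R" and "b \<in> carrier R"
  shows "(a \<oplus> b) [^] (p ^ n) = a [^] (p ^ n) \<oplus> b [^] (p ^ n)"
proof (induction n)
  case 0
  then show ?case using assms by simp
next
  case (Suc n)
  have "(a \<oplus> b) [^] (p ^ Suc n) = ((a \<oplus> b) [^] (p ^ n)) [^] p"
    using assms by (simp add: nat_pow_pow mult.commute)
  also have "\<dots> = (a [^] (p ^ n)) [^] p \<oplus> (b [^] (p ^ n)) [^] p"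
    using assms Suc by (simp add: freshmans_dream[OF prime_p char_p])
  finally show ?case using assms by (simp add: nat_pow_pow mult.commute)
qed

lemma frobenius_uminus:
  assumes "a \<in> carrier R"
  shows "(\<ominus> a) [^] (p ^ n) = \<ominus> (a [^] (p ^ n))"
proof -
  have pos: "p ^ n \<noteq> 0" using prime_gt_0_nat[OF prime_p] by simp
  have "(\<ominus> a) [^] (p ^ n) \<oplus> a [^] (p ^ n) = (\<ominus> a \<oplus> a) [^] (p ^ n)"
    using assms frobenius_add by simp
  also have "\<dots> = \<zero>"
    using assms pos by (simp add: l_neg nat_pow_zero)
  finally show ?thesis
    using assms by (simp add: minus_equality[symmetric])
qed

section \<open>The exchange property for extensions of exponent one\<close>

abbreviation P where "P \<equiv> poly_ring R"

text \<open>
  The polynomial \<open>(X - x)\<^sup>p\<close> equals \<open>X\<^sup>p - x\<^sup>p\<close>, so its coefficients lie in every subfield that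
  contains \<open>x\<^sup>p\<close>.
\<close>

lemma linear_power:
  assumes N: "subfield N R" and x: "x \<in> carrier R" and xp: "x [^] p \<in> N"
  shows "[\<one>, \<ominus> x] [^]\<^bsub>P\<^esub> p \<in> carrier (N[X])"
proof -
  have sR: "subring (carrier R) R" by (rule carrier_is_subring)
  have sN: "subring N R" using subfieldE(1)[OF N] .
  interpret UP: domain P using univ_poly_is_domain[OF sR] .
  interpret UN: domain "N[X]" using univ_poly_is_domain[OF sN] .
  interpret C: ring_hom_ring "R\<lparr>carrier := carrier R\<rparr>" P poly_of_const
    using canonical_embedding_ring_hom[OF sR] .
  have "[p] \<cdot>\<^bsub>P\<^esub> \<one>\<^bsub>P\<^esub> = \<zero>\<^bsub>P\<^esub>"
  proof -
    have "poly_of_const ([n] \<cdot> \<one>) = [n] \<cdot>\<^bsub>P\<^esub> \<one>\<^bsub>P\<^esub>" for n :: nat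
    proof (induction n)
      case 0
      then show ?case using C.hom_zero by simp
    next
      case (Suc n)
      then show ?case using C.hom_add[of "[n] \<cdot> \<one>" \<one>] C.hom_one by simp
    qed
    from this[of p] show ?thesis using char_p C.hom_zero by simp
  qed
  note fd = UP.freshmans_dream[OF prime_p this]
  have Xc: "X \<in> carrier P" "poly_of_const (\<ominus> x) \<in> carrier P"
    using var_closed(1)[OF sR] x C.hom_closed by auto
  have pw: "q [^]\<^bsub>P\<^esub> (n::nat) = q [^]\<^bsub>N[X]\<^esub> n" for q n
    by (induction n) (simp_all add: nat_pow_def univ_poly_mult univ_poly_one)
  have "[\<one>, \<ominus> x] = X \<oplus>\<^bsub>P\<^esub> poly_of_const (\<ominus> x)"
    using x by (auto simp: var_def poly_of_const_def univ_poly_add)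
  then have "[\<one>, \<ominus> x] [^]\<^bsub>P\<^esub> p = X [^]\<^bsub>P\<^esub> p \<oplus>\<^bsub>P\<^esub> poly_of_const (\<ominus> x) [^]\<^bsub>P\<^esub> p"
    using fd Xc by simp
  also have "poly_of_const (\<ominus> x) [^]\<^bsub>P\<^esub> p = poly_of_const ((\<ominus> x) [^] p)"
  proof -
    have "poly_of_const (\<ominus> x) [^]\<^bsub>P\<^esub> n = poly_of_const ((\<ominus> x) [^] n)" for n :: nat
    proof (induction n)
      case 0
      then show ?case using C.hom_one by simp
    next
      case (Suc n)
      then show ?case using C.hom_mult[of "(\<ominus> x) [^] n" "\<ominus> x"] x by simp
    qed
    then show ?thesis .
  qed
  also have "(\<ominus> x) [^] p = \<ominus> (x [^] p)" using frobenius_uminus[OF x, of 1] by simp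
  also have "X [^]\<^bsub>P\<^esub> p \<oplus>\<^bsub>P\<^esub> poly_of_const (\<ominus> (x [^] p)) =
      X [^]\<^bsub>N[X]\<^esub> p \<oplus>\<^bsub>N[X]\<^esub> poly_of_const (\<ominus> (x [^] p))"
    by (simp add: pw univ_poly_add)
  also have "\<dots> \<in> carrier (N[X])"
  proof -
    have "\<ominus> (x [^] p) \<in> N" using xp subringE(5)[OF sN] by simp
    then have "poly_of_const (\<ominus> (x [^] p)) \<in> carrier (N[X])"
      using ring_hom_memE(1)[OF canonical_embedding_is_hom[OF sN]] by simp
    then show ?thesis using var_closed(1)[OF sN] by auto
  qed
  finally show ?thesis .
qed

lemma roots_linear_power:
  assumes x: "x \<in> carrier R"
  shows "roots ([\<one>, \<ominus> x] [^]\<^bsub>P\<^esub> (n::nat)) = replicate_mset n x \<and>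
    [\<one>, \<ominus> x] [^]\<^bsub>P\<^esub> n \<noteq> [] \<and> lead_coeff ([\<one>, \<ominus> x] [^]\<^bsub>P\<^esub> n) = \<one>"
proof -
  interpret UP: domain P using univ_poly_is_domain[OF carrier_is_subring] .
  have c: "[\<one>, \<ominus> x] \<in> carrier P"
    using x unfolding univ_poly_carrier[symmetric] polynomial_def by auto
  show ?thesis
  proof (induction n)
    case 0
    have "roots \<one>\<^bsub>P\<^esub> = {#}"
      by (intro degree_zero_imp_empty_roots UP.one_closed) (simp add: univ_poly_one)
    then show ?case by (simp add: univ_poly_one)
  next
    case (Suc n)
    let ?q = "[\<one>, \<ominus> x] [^]\<^bsub>P\<^esub> n"
    have q: "?q \<in> carrier P" using c by auto
    have eq: "[\<one>, \<ominus> x] [^]\<^bsub>P\<^esub> Suc n = [\<one>, \<ominus> x] \<otimes>\<^bsub>P\<^esub> ?q"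
      using c q UP.m_comm by simp
    have "roots ([\<one>, \<ominus> x] \<otimes>\<^bsub>P\<^esub> ?q) = add_mset x (roots ?q)"
      using poly_mult_degree_one_monic_imp_same_roots[OF x q] Suc by blast
    moreover have "[\<one>, \<ominus> x] \<otimes>\<^bsub>P\<^esub> ?q \<noteq> []"
      using polynomial_pow_not_zero[OF c, of "Suc n"] eq by simp
    moreover have "lead_coeff (poly_mult [\<one>, \<ominus> x] ?q) = \<one> \<otimes> \<one>"
      using poly_mult_lead_coeff[OF carrier_is_subring, of "[\<one>, \<ominus> x]" ?q] c q Suc
      by (simp add: univ_poly_carrier)
    ultimately show ?case unfolding eq using Suc by (simp add: univ_poly_mult)
  qed
qed

text \<open>
  The minimal polynomial \<open>f\<close> of \<open>x\<close> over \<open>N\<close> divides \<open>(X - x)\<^sup>p\<close>, hence \<open>f = (X - x)\<^sup>d\<close>, and its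
  constant term shows \<open>(-x)\<^sup>d \<in> N\<close>. If \<open>d < p\<close>, then \<open>d\<close> and \<open>p\<close> are coprime, and \<open>-x\<close> is a quotient
  of powers of \<open>(-x)\<^sup>d\<close> and \<open>(-x)\<^sup>p\<close>, so \<open>x \<in> N\<close>.
\<close>

lemma degree_Irr_pth_root:
  assumes N: "subfield N R" and x: "x \<in> carrier R" and xp: "x [^] p \<in> N" and nx: "x \<notin> N"
  shows "(algebraic over N) x" and "degree (Irr N x) = p"
proof -
  have sR: "subring (carrier R) R" by (rule carrier_is_subring)
  have sN: "subring N R" using subfieldE(1)[OF N] .
  interpret UP: domain P using univ_poly_is_domain[OF sR] .
  let ?l = "[\<one>, \<ominus> x]" let ?q = "?l [^]\<^bsub>P\<^esub> p" let ?f = "Irr N x" let ?d = "degree (Irr N x)"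
  have l: "?l \<in> carrier P"
    using x unfolding univ_poly_carrier[symmetric] polynomial_def by auto
  have q: "?q \<in> carrier (N[X])" by (rule linear_power[OF N x xp])
  have qP: "?q \<in> carrier P" using l by auto
  note rq = roots_linear_power[OF x, of p]
  have ev: "eval (?l [^]\<^bsub>P\<^esub> n) y = (y \<ominus> x) [^] n" if y: "y \<in> carrier R" for n :: nat and y
  proof -
    interpret E: ring_hom_ring P R "\<lambda>f. eval f y" using eval_ring_hom[OF sR y] .
    show ?thesis
    proof (induction n)
      case 0
      then show ?case by (simp add: E.hom_one)
    next
      case (Suc n)
      have "eval (?l [^]\<^bsub>P\<^esub> n \<otimes>\<^bsub>P\<^esub> ?l) y = eval (?l [^]\<^bsub>P\<^esub> n) y \<otimes> eval ?l y"
        using l by (intro E.hom_mult) auto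
      then show ?case using Suc x y by (simp add: minus_eq)
    qed
  qed
  have ev0: "eval ?q x = \<zero>"
    using ev[OF x, of p] x prime_gt_0_nat[OF prime_p] by (simp add: nat_pow_zero minus_eq r_neg)
  show alg: "(algebraic over N) x"
    using algebraicI[OF q _ ev0] rq by simp
  note I = IrrE[OF N x alg]
  have f: "?f \<in> carrier P" using carrier_polynomial_shell[OF sN I(1)] .
  have fn: "?f \<noteq> []" using pirreducibleE(1)[OF sN I(1,2)] .
  have d1: "?d \<ge> 1" using pirreducible_degree[OF N I(1,2)] .
  have dq: "degree ?q = p" using polynomial_pow_degree[OF l, of p] by simp
  have fq: "?f pdivides ?q" using Irr_minimal[OF N x alg q ev0] .
  have dp: "?d \<le> p" using pdivides_imp_degree_le[OF sR f qP _ fq] rq dq by simp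
  have "splitted ?q" using rq dq by (simp add: splitted_def)
  then have "splitted ?f" using pdivides_imp_splitted[OF f qP _ _ fq] rq by simp
  then have sz: "size (roots ?f) = ?d" by (simp add: splitted_def)
  have "roots ?f \<subseteq># replicate_mset p x" using pdivides_imp_roots_incl[OF f qP _ fq] rq by simp
  then have "roots ?f = replicate_mset ?d x"
    using sz by (metis size_replicate_mset msubseteq_replicate_msetE)
  then have "alg_mult ?f x = ?d" using alg_mult_eq_count_roots[OF f] by simp
  then have "(?l [^]\<^bsub>P\<^esub> ?d) pdivides ?f" using alg_multE(1)[OF x f fn] by simp
  then obtain r where r: "r \<in> carrier P" and fr: "?f = ?l [^]\<^bsub>P\<^esub> ?d \<otimes>\<^bsub>P\<^esub> r"
    unfolding pdivides_def by (auto elim: dividesE)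
  have lp: "polynomial (carrier R) (?l [^]\<^bsub>P\<^esub> ?d)" using l by (simp add: univ_poly_carrier)
  have rp: "polynomial (carrier R) r" using r by (simp add: univ_poly_carrier)
  have rn: "r \<noteq> []" using fr fn UP.r_null[of "?l [^]\<^bsub>P\<^esub> ?d"] l by (auto simp: univ_poly_zero)
  have "degree (?l [^]\<^bsub>P\<^esub> ?d) = ?d" using polynomial_pow_degree[OF l, of ?d] by simp
  moreover have "degree ?f = degree (?l [^]\<^bsub>P\<^esub> ?d) + degree r"
    using poly_mult_degree_eq[OF sR lp rp] fr rn roots_linear_power[OF x, of ?d]
    by (simp add: univ_poly_mult)
  ultimately have "degree r = 0" by simp
  then obtain u where u: "r = [u]" using rn by (cases r) auto
  have "\<one> = lead_coeff (?l [^]\<^bsub>P\<^esub> ?d) \<otimes> lead_coeff r"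
    using poly_mult_lead_coeff[OF sR lp rp] fr rn roots_linear_power[OF x, of ?d] I(3)
    by (simp add: univ_poly_mult)
  then have "u = \<one>" using u rp roots_linear_power[OF x, of ?d] by (simp add: polynomial_def)
  then have "?f = ?l [^]\<^bsub>P\<^esub> ?d" using fr u UP.r_one l by (simp add: univ_poly_one)
  then have "eval ?f \<zero> = (\<ominus> x) [^] ?d" using ev[of \<zero> ?d] x by (simp add: minus_eq)
  moreover have "eval ?f \<zero> \<in> N"
    using I(1) fn ring.eval_in_carrier[OF subring_is_ring[OF sN], of ?f \<zero>] subringE(2)[OF sN]
    by (simp add: eval_consistent[OF sN] univ_poly_carrier[symmetric] polynomial_def)
  ultimately have xd: "(\<ominus> x) [^] ?d \<in> N" by simp
  have xp': "(\<ominus> x) [^] p \<in> N"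
    using frobenius_uminus[OF x, of 1] xp subringE(5)[OF sN] by simp
  have powN: "z [^] n \<in> N" if "z \<in> N" for z and n :: nat
    using that subringE(3,6)[OF sN] by (induction n) auto
  show "?d = p"
  proof (rule ccontr)
    assume "?d \<noteq> p"
    then have "coprime ?d p"
      using d1 dp prime_p by (metis coprime_commute dvd_imp_le le_antisym le_zero_eq not_one_le_zero
          prime_imp_coprime less_eq_Suc_le gr0I)
    \<comment> \<open>hence \<open>-x\<close> is \<open>(-x)\<^bsup>d a\<^esup>\<close> divided by \<open>(-x)\<^bsup>p b\<^esup>\<close>\<close>
    then obtain a b where ab: "?d * a = p * b + 1"
      using bezout_nat[of ?d p] d1 by (metis coprime_imp_gcd_eq_1 not_one_le_zero)
    define y z where "y = ((\<ominus> x) [^] ?d) [^] a" and "z = ((\<ominus> x) [^] p) [^] b"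
    have yz: "y = z \<otimes> \<ominus> x"
    proof -
      have "y = (\<ominus> x) [^] (p * b + 1)" unfolding y_def using x ab by (simp only: nat_pow_pow a_inv_closed)
      also have "\<dots> = z \<otimes> \<ominus> x" unfolding z_def using x by (simp add: nat_pow_pow)
      finally show ?thesis .
    qed
    have yN: "y \<in> N" and zN: "z \<in> N" unfolding y_def z_def using xd xp' powN by auto
    have "x \<noteq> \<zero>" using nx subringE(2)[OF sN] by auto
    then have "\<ominus> x \<noteq> \<zero>" using x by (metis minus_minus minus_zero)
    then have "(\<ominus> x) [^] n \<noteq> \<zero>" for n :: nat
      using x by (induction n) (auto simp: integral_iff)
    then have z: "z \<in> carrier R" "z \<noteq> \<zero>"
      unfolding z_def using x by (auto simp: nat_pow_pow)
    have "inv z \<in> N" using subfield_m_inv(1)[OF N] zN z by simp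
    then have "inv z \<otimes> y \<in> N" using yN subringE(6)[OF sN] by simp
    moreover have "inv z \<otimes> y = \<ominus> x"
    proof -
      have zU: "z \<in> Units R" using z field_Units by simp
      then have "inv z \<otimes> (z \<otimes> \<ominus> x) = (inv z \<otimes> z) \<otimes> \<ominus> x" using x z by (intro m_assoc[symmetric]) auto
      then show ?thesis unfolding yz using zU x by simp
    qed
    ultimately have "\<ominus> x \<in> N" by simp
    then show False using nx x subringE(5)[OF sN] by (metis minus_minus)
  qed
qed

text \<open>
  If \<open>x \<notin> N = M(y)\<close>, then \<open>1, x, ..., x\<^bsup>p-1\<^esup>\<close> are independent over \<open>N\<close> while they span \<open>M(x)\<close> over
  \<open>M\<close>. Expanding \<open>y \<in> M(x)\<close> with coefficients in \<open>M\<close> and comparing with the expansion \<open>y = y 1\<close> over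
  \<open>N\<close> shows that \<open>y\<close> is one of the coefficients, so \<open>y \<in> M\<close>.
\<close>

lemma exchange:
  assumes M: "subfield M R" and x: "x \<in> carrier R" and xp: "x [^] p \<in> M"
    and y: "y \<in> generate_field R (M \<union> {x})" "y \<notin> M"
  shows "x \<in> generate_field R (M \<union> {y})"
proof (rule ccontr)
  let ?N = "generate_field R (M \<union> {y})"
  assume nx: "x \<notin> ?N"
  have Mc: "M \<subseteq> carrier R" using subfieldE(3)[OF M] .
  have yc: "y \<in> carrier R" using y(1) generate_field_in_carrier[of "M \<union> {x}" y] Mc x by simp
  have N: "subfield ?N R" using generate_field_is_subfield[of "M \<union> {y}"] Mc yc by simp
  have MN: "M \<subseteq> ?N" and yN: "y \<in> ?N" by (auto intro: generate_field.incl)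
  have nM: "x \<notin> M" using nx MN by auto
  note dM = degree_Irr_pth_root[OF M x xp nM]
  note dN = degree_Irr_pth_root[OF N x subsetD[OF MN xp] nx]
  have len: "length (exp_base x p) = p" by (simp add: exp_base_def)
  have "generate_field R (M \<union> {x}) \<subseteq> simple_extension M x"
    using dM(1) simple_extension_is_subfield[OF M x] simple_extension_incl[OF Mc x]
      simple_extension_mem[OF subfieldE(1)[OF M] x] Mc x
    by (intro generate_field_min_subfield1) auto
  then have "y \<in> Span M (exp_base x p)" using y(1) Span_exp_base[OF M x dM(1)] dM(2) by auto
  then obtain Ks where Ks: "set Ks \<subseteq> M" "length Ks = p" "y = combine Ks (exp_base x p)"
    using Span_mem_iff_length_version[OF M exp_base_closed[OF x, of p], of y]
    unfolding len by blast
  have ind: "independent ?N (exp_base x p)"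
    using exp_base_independent[OF N x dN(1)] dN(2) by simp
  \<comment> \<open>\<open>exp_base\<close> lists the powers in descending order, so the coefficient of \<open>1\<close> comes last\<close>
  let ?Ls = "replicate (p - 1) \<zero> @ [y]"
  have p0: "p > 0" using prime_gt_0_nat[OF prime_p] .
  have yL: "y = combine ?Ls (exp_base x p)"
  proof -
    have "combine ?Ls (exp_base x p) = combine [y] (drop (p - 1) (exp_base x p))"
      using combine_prepend_replicate[of "[y]" "exp_base x p" "p - 1"] yc exp_base_closed[OF x] by simp
    also have "drop (p - 1) (exp_base x p) = [\<one>]"
      proof -
        have "p - (p - 1) = 1" using p0 by simp
        then show ?thesis using drop_exp_base[of "p - 1" x p] by (simp add: exp_base_def)
      qed
    finally show ?thesis using yc by simp
  qed
  have "y \<in> Span ?N (exp_base x p)"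
    using Span_mem_iff_length_version[OF N exp_base_closed[OF x, of p], of y] Ks MN
    unfolding len by blast
  then have "\<exists>!Ks. set Ks \<subseteq> ?N \<and> length Ks = p \<and> y = combine Ks (exp_base x p)"
    using unique_decomposition[OF N ind, of y] unfolding len by blast
  moreover have "set ?Ls \<subseteq> ?N"
    using yN zero_in_generate by auto
  moreover have "length ?Ls = p" using p0 by simp
  ultimately have "?Ls = Ks"
    using Ks MN yL by (metis (no_types, lifting) subset_trans)
  then have "y \<in> set Ks" by (metis in_set_conv_decomp)
  then show False using Ks(1) y(2) by auto
qed

end

section \<open>Adjoining elements to a subfield\<close>

definition adjoin :: "('a, 'b) ring_scheme \<Rightarrow> 'a set \<Rightarrow> 'a set \<Rightarrow> 'a set" where
  "adjoin R k S = generate_field R (k \<union> S)"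

text \<open>
  A closure property that needs no hypothesis on carriers; it makes adjunction a closure operator
  on arbitrary sets and keeps side conditions out of the lemmas below.
\<close>

lemma generate_field_closure:
  assumes "S \<subseteq> generate_field R H"
  shows "generate_field R S \<subseteq> generate_field R H"
proof
  show "x \<in> generate_field R H" if "x \<in> generate_field R S" for x
    using that by induction (use assms in \<open>auto intro: generate_field.intros\<close>)
qed

lemma adjoin_base: "k \<subseteq> adjoin R k S" and adjoin_gens: "S \<subseteq> adjoin R k S"
  unfolding adjoin_def by (auto intro: generate_field.incl)

lemma adjoin_least: "k \<subseteq> adjoin R k' S' \<Longrightarrow> S \<subseteq> adjoin R k' S' \<Longrightarrow> adjoin R k S \<subseteq> adjoin R k' S'"
  unfolding adjoin_def by (intro generate_field_closure) auto

lemma adjoin_mono: "k \<subseteq> k' \<Longrightarrow> S \<subseteq> S' \<Longrightarrow> adjoin R k S \<subseteq> adjoin R k' S'"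
  by (meson adjoin_base adjoin_gens adjoin_least subset_trans)

lemma adjoin_adjoin: "adjoin R (adjoin R k S) T = adjoin R k (S \<union> T)"
proof
  show "adjoin R (adjoin R k S) T \<subseteq> adjoin R k (S \<union> T)"
    using adjoin_mono[OF order.refl, of S "S \<union> T" R k] adjoin_gens[of "S \<union> T" R k]
      adjoin_base[of k R "S \<union> T"]
    by (intro adjoin_least) auto
  show "adjoin R k (S \<union> T) \<subseteq> adjoin R (adjoin R k S) T"
    using adjoin_base[of k R S] adjoin_gens[of S R k] adjoin_base[of "adjoin R k S" R T]
      adjoin_gens[of T R "adjoin R k S"]
    by (intro adjoin_least) auto
qed

lemma adjoin_redundant: "S \<subseteq> adjoin R k T \<Longrightarrow> adjoin R k (S \<union> T) = adjoin R k T"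
  by (intro equalityI adjoin_least adjoin_mono) (auto simp: adjoin_base intro: subsetD[OF adjoin_gens])

lemma adjoin_finitary:
  assumes "x \<in> adjoin R k S"
  obtains F where "finite F" "F \<subseteq> S" "x \<in> adjoin R k F"
proof -
  have "\<exists>F. finite F \<and> F \<subseteq> S \<and> x \<in> generate_field R (k \<union> F)"
    using assms unfolding adjoin_def
  proof induction
    case one
    then show ?case by (auto intro: generate_field.one)
  next
    case (incl h)
    then show ?case by (intro exI[of _ "{h} \<inter> S"]) (auto intro: generate_field.incl)
  next
    case (a_inv h)
    then show ?case by (auto intro: generate_field.a_inv)
  next
    case (m_inv h)
    then show ?case by (auto intro: generate_field.m_inv)
  next
    case (eng_add h1 h2)
    then obtain F1 F2 where "finite F1" "F1 \<subseteq> S" "h1 \<in> generate_field R (k \<union> F1)"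
      "finite F2" "F2 \<subseteq> S" "h2 \<in> generate_field R (k \<union> F2)" by blast
    then show ?case
      using adjoin_mono[of k k F1 "F1 \<union> F2" R] adjoin_mono[of k k F2 "F1 \<union> F2" R]
      by (intro exI[of _ "F1 \<union> F2"]) (auto simp: adjoin_def intro!: generate_field.eng_add)
  next
    case (eng_mult h1 h2)
    then obtain F1 F2 where "finite F1" "F1 \<subseteq> S" "h1 \<in> generate_field R (k \<union> F1)"
      "finite F2" "F2 \<subseteq> S" "h2 \<in> generate_field R (k \<union> F2)" by blast
    then show ?case
      using adjoin_mono[of k k F1 "F1 \<union> F2" R] adjoin_mono[of k k F2 "F1 \<union> F2" R]
      by (intro exI[of _ "F1 \<union> F2"]) (auto simp: adjoin_def intro!: generate_field.eng_mult)
  qed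
  then show thesis using that by (auto simp: adjoin_def)
qed

lemma (in field) adjoin_subfield:
  "k \<subseteq> carrier R \<Longrightarrow> S \<subseteq> carrier R \<Longrightarrow> subfield (adjoin R k S) R"
  unfolding adjoin_def by (intro generate_field_is_subfield) auto

lemma (in field) adjoin_le_subfield:
  "subfield E R \<Longrightarrow> k \<subseteq> E \<Longrightarrow> S \<subseteq> E \<Longrightarrow> adjoin R k S \<subseteq> E"
  unfolding adjoin_def
  by (intro generate_field_min_subfield1) (auto dest: subsetD[OF subfieldE(3)])

lemma (in field) adjoin_trivial:
  "subfield k R \<Longrightarrow> S \<subseteq> k \<Longrightarrow> adjoin R k S = k"
  by (intro equalityI adjoin_le_subfield adjoin_base) auto

lemma adjoin_incseq_UN:
  assumes "incseq A" "x \<in> adjoin R l (\<Union>n. A n)"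
  obtains n where "x \<in> adjoin R l (A (n::nat))"
proof -
  obtain F where F: "finite F" "F \<subseteq> (\<Union>n. A n)" "x \<in> adjoin R l F"
    using assms(2) by (rule adjoin_finitary)
  obtain n where "F \<subseteq> A n" using finite_subset_incseq_UN[OF assms(1) F(1,2)] .
  then have "x \<in> adjoin R l (A n)" using F(3) adjoin_mono[OF order.refl, of F "A n" R l] by auto
  then show thesis by (rule that)
qed

lemma (in field) subfield_Int:
  assumes E: "subfield E R" and K: "subfield K R"
  shows "subfield (K \<inter> E) R"
proof (rule subfieldI'[OF subringI])
  note e = subringE[OF subfieldE(1)[OF E]] and s = subringE[OF subfieldE(1)[OF K]]
  show "K \<inter> E \<subseteq> carrier R" using e(1) by (rule le_infI2)
  show "\<one> \<in> K \<inter> E" using e(3) s(3) by (rule IntI[rotated])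
  fix x y assume xy: "x \<in> K \<inter> E" "y \<in> K \<inter> E"
  show "\<ominus> x \<in> K \<inter> E" using xy e(5) s(5) by simp
  show "x \<oplus> y \<in> K \<inter> E" using xy e(7) s(7) by simp
  show "x \<otimes> y \<in> K \<inter> E" using xy e(6) s(6) by simp
next
  fix x assume "x \<in> K \<inter> E - {\<zero>}"
  then show "inv x \<in> K \<inter> E"
    using subfield_m_inv(1)[OF E, of x] subfield_m_inv(1)[OF K, of x] by simp
qed

section \<open>Irredundant families and Steinitz exchange\<close>

text \<open>
  For \<open>k\<close> containing all \<open>p\<close>-th powers this is \<open>p\<close>-independence over \<open>k\<close>; in general it says that
  \<open>B\<close> is a minimal set of generators of \<open>k(B)/k\<close>. The second condition in the definition of an
  \<open>r\<close>-base of \<open>K/k\<close> is irredundance over \<open>k(K\<^sup>p)\<close>.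
\<close>

definition irredundant :: "('a, 'b) ring_scheme \<Rightarrow> 'a set \<Rightarrow> 'a set \<Rightarrow> bool" where
  "irredundant R k B \<longleftrightarrow> (\<forall>b\<in>B. b \<notin> adjoin R k (B - {b}))"

lemma irredundant_subset: "irredundant R k B \<Longrightarrow> C \<subseteq> B \<Longrightarrow> irredundant R k C"
  unfolding irredundant_def using adjoin_mono[of k k] by (metis Diff_mono order.refl subsetD)

context char_p_field
begin

lemma adjoin_exchange:
  assumes "subfield M R" "S \<subseteq> carrier R" "x \<in> carrier R" "x [^] p \<in> M"
    and "y \<in> adjoin R M (insert x S)" "y \<notin> adjoin R M S"
  shows "x \<in> adjoin R M (insert y S)"
proof -
  have "subfield (adjoin R M S) R" using assms subfieldE(3) by (intro adjoin_subfield) auto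
  from exchange[OF this assms(3), of y] assms adjoin_base[of M R S]
  have "x \<in> adjoin R (adjoin R M S) {y}"
    using adjoin_adjoin[of R M S "{x}"] by (auto simp: adjoin_def)
  then show ?thesis by (simp add: adjoin_adjoin)
qed

lemma irredundant_insert:
  assumes M: "subfield M R" and B: "B \<subseteq> carrier R" and ir: "irredundant R M B"
    and a: "a \<in> carrier R" "a [^] p \<in> M" "a \<notin> adjoin R M B"
  shows "irredundant R M (insert a B)"
  unfolding irredundant_def
proof
  fix b assume b: "b \<in> insert a B"
  show "b \<notin> adjoin R M (insert a B - {b})"
  proof (cases "b = a")
    case True
    then show ?thesis using a(3) adjoin_mono[of M M "insert a B - {b}" B R] by auto
  next
    case False
    with b have bB: "b \<in> B" by simp
    have eq: "insert a B - {b} = insert a (B - {b})" "insert b (B - {b}) = B" using False bB by auto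
    show ?thesis
      using adjoin_exchange[OF M _ a(1,2), of "B - {b}" b] B ir bB a(3)
      unfolding eq irredundant_def by auto
  qed
qed

text \<open>
  Enlarging the base field by \<open>z\<close> costs at most one element. If \<open>B\<close> becomes redundant because of
  \<open>b\<close>, exchange gives \<open>z \<in> M(B)\<close> with \<open>b\<close> essential; a second redundancy among \<open>B - {b}\<close> would put
  \<open>z\<close>, and then \<open>b\<close>, into \<open>M(B - {b})\<close>.
\<close>

lemma irredundant_remove:
  assumes M: "subfield M R" and B: "B \<subseteq> carrier R" "B \<noteq> {}" and ir: "irredundant R M B"
    and z: "z \<in> carrier R" "z [^] p \<in> M"
  obtains b where "b \<in> B" "irredundant R (adjoin R M {z}) (B - {b})"
proof (cases "irredundant R (adjoin R M {z}) B")
  case True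
  then show thesis using that B irredundant_subset by (metis Diff_subset ex_in_conv)
next
  case False
  then obtain b where b: "b \<in> B" "b \<in> adjoin R M (insert z (B - {b}))"
    unfolding irredundant_def by (auto simp: adjoin_adjoin)
  have nb: "b \<notin> adjoin R M (B - {b})" using ir b(1) unfolding irredundant_def by simp
  have "irredundant R (adjoin R M {z}) (B - {b})"
    unfolding irredundant_def
  proof
    fix c assume c: "c \<in> B - {b}"
    let ?S = "B - {b} - {c}"
    show "c \<notin> adjoin R (adjoin R M {z}) ?S"
    proof
      assume "c \<in> adjoin R (adjoin R M {z}) ?S"
      then have cz: "c \<in> adjoin R M (insert z ?S)" by (simp add: adjoin_adjoin)
      have "irredundant R M (B - {b})" using irredundant_subset[OF ir] by auto
      then have nc: "c \<notin> adjoin R M ?S" using c unfolding irredundant_def by blast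
      have "?S \<subseteq> carrier R" using B by auto
      from adjoin_exchange[OF M this z cz nc] have "z \<in> adjoin R M (insert c ?S)" .
      moreover have "insert c ?S = B - {b}" using c by auto
      ultimately have "insert z (B - {b}) \<subseteq> adjoin R M (B - {b})" by (simp add: adjoin_gens)
      then have "b \<in> adjoin R M (B - {b})"
        using b(2) adjoin_least[OF adjoin_base, of "insert z (B - {b})"] by blast
      with nb show False ..
    qed
  qed
  with b(1) show thesis using that by blast
qed

text \<open>
  Induction on \<open>G\<close>: one generator is moved into the base field, at the price of one element of \<open>B\<close>.
\<close>

lemma steinitz:
  assumes "finite G" "subfield M R" "G \<subseteq> carrier R" "B \<subseteq> carrier R" "finite B"
    and "\<And>x. x \<in> G \<Longrightarrow> x [^] p \<in> M" "irredundant R M B" "B \<subseteq> adjoin R M G"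
  shows "card B \<le> card G"
  using assms
proof (induction G arbitrary: M B rule: finite_induct)
  case empty
  then have "B \<subseteq> M" using adjoin_trivial by blast
  then have "b \<in> adjoin R M (B - {b})" if "b \<in> B" for b using that adjoin_base[of M R "B - {b}"] by auto
  then have "B = {}" using empty.prems(6) unfolding irredundant_def by auto
  then show ?case by simp
next
  case (insert z G)
  show ?case
  proof (cases "B = {}")
    case False
    obtain b where b: "b \<in> B" "irredundant R (adjoin R M {z}) (B - {b})"
      using irredundant_remove[OF insert.prems(1,3) False insert.prems(6), of z] insert.prems by auto
    have "card (B - {b}) \<le> card G"
    proof (rule insert.IH[OF _ _ _ _ _ b(2)])
      show "subfield (adjoin R M {z}) R"
        using insert.prems subfieldE(3) by (intro adjoin_subfield) auto
      show "x [^] p \<in> adjoin R M {z}" if "x \<in> G" for x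
        using insert.prems(5) that by (auto intro: subsetD[OF adjoin_base])
      show "B - {b} \<subseteq> adjoin R (adjoin R M {z}) G"
        using insert.prems(7) by (auto simp: adjoin_adjoin)
    qed (use insert.prems in auto)
    then show ?thesis using b(1) insert by (simp add: card_Diff_singleton)
  qed simp
qed

section \<open>Monotonicity of the size of irredundant generating sets\<close>

text \<open>
  To show that \<open>p\<^sup>n\<close>-th powers of a generated field lie in \<open>E\<close> it thus suffices to check generators.
\<close>

lemma subfield_frobenius_vimage:
  assumes E: "subfield E R"
  shows "subfield {x \<in> carrier R. x [^] (p ^ n) \<in> E} R"
proof (rule subfieldI'[OF subringI])
  note sE = subringE[OF subfieldE(1)[OF E]]
  show "\<one> \<in> {x \<in> carrier R. x [^] (p ^ n) \<in> E}" using sE(3) by simp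
  fix x y assume x: "x \<in> {x \<in> carrier R. x [^] (p ^ n) \<in> E}" and y: "y \<in> {x \<in> carrier R. x [^] (p ^ n) \<in> E}"
  show "\<ominus> x \<in> {x \<in> carrier R. x [^] (p ^ n) \<in> E}" using x sE(5) by (simp add: frobenius_uminus)
  show "x \<otimes> y \<in> {x \<in> carrier R. x [^] (p ^ n) \<in> E}" using x y sE(6) by (simp add: nat_pow_distrib)
  show "x \<oplus> y \<in> {x \<in> carrier R. x [^] (p ^ n) \<in> E}" using x y sE(7) by (simp add: frobenius_add)
next
  fix x assume x: "x \<in> {x \<in> carrier R. x [^] (p ^ n) \<in> E} - {\<zero>}"
  have nz: "x [^] m \<noteq> \<zero>" for m :: nat using x by (induction m) (auto simp: integral_iff)
  show "inv x \<in> {x \<in> carrier R. x [^] (p ^ n) \<in> E}"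
    using x nz inv_nat_pow[of x] subfield_m_inv(1)[OF E, of "x [^] (p ^ n)"] field_Units by auto
qed auto

lemma frobenius_adjoin:
  assumes k: "subfield k R" and S: "S \<subseteq> carrier R" and x: "x \<in> adjoin R k S"
  shows "x [^] (p ^ n) \<in> adjoin R k ((\<lambda>x. x [^] (p ^ n)) ` S)"
proof -
  let ?E = "adjoin R k ((\<lambda>x. x [^] (p ^ n)) ` S)"
  have E: "subfield ?E R" using k S subfieldE(3) by (intro adjoin_subfield) auto
  have pw: "x [^] m \<in> ?E" if "x \<in> k" for x and m :: nat
    using that adjoin_base[of k R] subringE(3,6)[OF subfieldE(1)[OF E]] by (induction m) auto
  have "adjoin R k S \<subseteq> {x \<in> carrier R. x [^] (p ^ n) \<in> ?E}"
    using S pw adjoin_gens[of "(\<lambda>x. x [^] (p ^ n)) ` S" R k]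
    by (intro adjoin_le_subfield subfield_frobenius_vimage E)
      (auto dest: subsetD[OF subfieldE(3)[OF k]])
  then show ?thesis using x by auto
qed

definition frob_field :: "'a set \<Rightarrow> 'a set \<Rightarrow> 'a set" where
  "frob_field k K = adjoin R k ((\<lambda>x. x [^] p) ` K)"

lemma r_span_eq: "r_span R p K k B = adjoin R (frob_field k K) B"
  by (simp add: r_span_def frob_field_def adjoin_adjoin) (simp add: adjoin_def Un_assoc)

lemma frob_field_subfield:
  assumes "subfield k R" "K \<subseteq> carrier R"
  shows "subfield (frob_field k K) R"
  unfolding frob_field_def using assms subfieldE(3) by (intro adjoin_subfield) auto

lemma frob_field_subset:
  assumes "subfield K R" "k \<subseteq> K"
  shows "frob_field k K \<subseteq> K"
  unfolding frob_field_def using assms subfield_pow_closed by (intro adjoin_le_subfield) auto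

lemma pow_in_frob_field: "x \<in> K \<Longrightarrow> x [^] p \<in> frob_field k K"
  unfolding frob_field_def by (auto intro: subsetD[OF adjoin_gens])

lemma frob_field_adjoin:
  assumes k: "subfield k R" and K: "subfield K R" and kK: "k \<subseteq> K" and S: "S \<subseteq> carrier R"
  shows "frob_field k (adjoin R K S) = adjoin R (frob_field k K) ((\<lambda>x. x [^] p) ` S)" (is "?L = ?R")
proof
  have Kc: "K \<subseteq> carrier R" using subfieldE(3)[OF K] .
  have F: "subfield (frob_field k K) R" using frob_field_subfield[OF k Kc] .
  have R: "subfield ?R R" using S subfieldE(3)[OF F] by (intro adjoin_subfield) auto
  have "adjoin R K S \<subseteq> {x \<in> carrier R. x [^] (p ^ 1) \<in> ?R}"
  proof (intro adjoin_le_subfield subfield_frobenius_vimage R)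
    show "K \<subseteq> {x \<in> carrier R. x [^] (p ^ 1) \<in> ?R}"
      using Kc pow_in_frob_field by (auto intro: subsetD[OF adjoin_base])
    show "S \<subseteq> {x \<in> carrier R. x [^] (p ^ 1) \<in> ?R}"
      using S by (auto intro: subsetD[OF adjoin_gens])
  qed
  then have "(\<lambda>x. x [^] p) ` adjoin R K S \<subseteq> ?R" by auto
  moreover have "k \<subseteq> ?R"
    unfolding frob_field_def adjoin_adjoin by (rule adjoin_base)
  ultimately show "?L \<subseteq> ?R"
    unfolding frob_field_def adjoin_adjoin by (intro adjoin_least) auto
  show "?R \<subseteq> ?L"
    unfolding frob_field_def adjoin_adjoin using adjoin_base[of K R S] adjoin_gens[of S R K]
    by (intro adjoin_mono) auto
qed

text \<open>
  Let \<open>a \<notin> K\<close> and write \<open>M = k(K\<^sup>p)\<close>, so that \<open>k(K(a)\<^sup>p) = M(a\<^sup>p)\<close>. If \<open>a\<^sup>p \<in> M\<close>,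
  the base field does not change and \<open>B\<close> survives. Otherwise some \<open>B - {b}\<close> stays irredundant over \<open>M(a\<^sup>p)\<close>, and since it generates a
  subfield of \<open>K\<close>, which does not contain \<open>a\<close>, the element \<open>a\<close> can be added to make up for \<open>b\<close>.
\<close>

lemma rank_step:
  assumes k: "subfield k R" and K: "subfield K R" and kK: "k \<subseteq> K"
    and a: "a \<in> carrier R" "a [^] p \<in> K"
    and B: "finite B" "B \<subseteq> K" "irredundant R (frob_field k K) B"
  shows "\<exists>B'. finite B' \<and> B' \<subseteq> adjoin R K {a} \<and> card B' = card B \<and>
           irredundant R (frob_field k (adjoin R K {a})) B'"
proof -
  let ?K' = "adjoin R K {a}" let ?M = "frob_field k K" let ?M' = "frob_field k (adjoin R K {a})"
  have Kc: "K \<subseteq> carrier R" using subfieldE(3)[OF K] .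
  have BK': "B \<subseteq> ?K'" using B(2) adjoin_base[of K R "{a}"] by auto
  have M: "subfield ?M R" using frob_field_subfield[OF k Kc] .
  have M': "?M' = adjoin R ?M {a [^] p}"
    using frob_field_adjoin[OF k K kK, of "{a}"] a by simp
  have M'f: "subfield ?M' R"
    using k a Kc by (intro frob_field_subfield subfieldE(3)[OF adjoin_subfield]) auto
  consider "a \<in> K" | "a \<notin> K" "a [^] p \<in> ?M" | "a \<notin> K" "a [^] p \<notin> ?M" "B = {}"
    | "a \<notin> K" "a [^] p \<notin> ?M" "B \<noteq> {}" by blast
  then show ?thesis
  proof cases
    case 1
    then have "?K' = K" using adjoin_trivial[OF K, of "{a}"] by simp
    then show ?thesis using B by auto
  next
    case 2
    then have "?M' = ?M" using M' adjoin_trivial[OF M, of "{a [^] p}"] by simp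
    then show ?thesis using B BK' by auto
  next
    case 3
    then show ?thesis by (auto simp: irredundant_def)
  next
    case 4
    have app: "(a [^] p) [^] p \<in> ?M" using pow_in_frob_field a(2) .
    have Bc: "B \<subseteq> carrier R" using B(2) Kc by (rule subset_trans)
    obtain b where b: "b \<in> B" "irredundant R ?M' (B - {b})"
      unfolding M' by (rule irredundant_remove[OF M Bc 4(3) B(3) nat_pow_closed[OF a(1)] app])
    have "?M' \<subseteq> K"
      unfolding M' using frob_field_subset[OF K kK] a by (intro adjoin_le_subfield K) auto
    then have "adjoin R ?M' (B - {b}) \<subseteq> K" using B(2) by (intro adjoin_le_subfield K) auto
    then have "a \<notin> adjoin R ?M' (B - {b})" using 4(1) by auto
    moreover have "a [^] p \<in> ?M'" unfolding M' by (auto intro: subsetD[OF adjoin_gens])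
    ultimately have "irredundant R ?M' (insert a (B - {b}))"
      using irredundant_insert[OF M'f _ b(2) a(1)] B(2) Kc by auto
    moreover have "card (insert a (B - {b})) = card B"
    proof -
      have "a \<notin> B" using 4(1) B(2) by auto
      then show ?thesis using b(1) B(1) by (simp add: card_Suc_Diff1 del: card_Diff_singleton_if card_Diff_insert)
    qed
    moreover have "insert a (B - {b}) \<subseteq> ?K'" using BK' adjoin_gens[of "{a}" R K] by auto
    ultimately show ?thesis using B(1) by (intro exI[of _ "insert a (B - {b})"]) auto
  qed
qed

text \<open>
  The chain \<open>K \<subseteq> K(a\<^bsup>p^(m-1)\<^esup>) \<subseteq> ... \<subseteq> K(a)\<close> consists of adjunctions of \<open>p\<close>-th roots.
\<close>

lemma rank_mono_simple:
  assumes k: "subfield k R"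
  shows "subfield K R \<Longrightarrow> k \<subseteq> K \<Longrightarrow> a \<in> carrier R \<Longrightarrow> a [^] (p ^ m) \<in> K \<Longrightarrow>
    finite B \<Longrightarrow> B \<subseteq> K \<Longrightarrow> irredundant R (frob_field k K) B \<Longrightarrow>
    \<exists>B'. finite B' \<and> B' \<subseteq> adjoin R K {a} \<and> card B' = card B \<and>
           irredundant R (frob_field k (adjoin R K {a})) B'"
proof (induction m arbitrary: a)
  case 0
  then have "adjoin R K {a} = K" using adjoin_trivial[of K "{a}"] by simp
  then show ?case using 0 by auto
next
  case (Suc m)
  let ?K = "adjoin R K {a [^] p}"
  have "(a [^] p) [^] (p ^ m) \<in> K" using Suc.prems by (simp add: nat_pow_pow)
  then obtain B' where B': "finite B'" "B' \<subseteq> ?K" "card B' = card B" "irredundant R (frob_field k ?K) B'"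
    using Suc.IH[of "a [^] p"] Suc.prems by auto
  have K: "subfield ?K R"
    using Suc.prems by (intro adjoin_subfield) (auto dest: subsetD[OF subfieldE(3)])
  have kK: "k \<subseteq> ?K" using Suc.prems(2) adjoin_base[of K R "{a [^] p}"] by auto
  have "{a [^] p} \<subseteq> adjoin R K {a}"
    using subfield_pow_closed[OF adjoin_subfield[of K "{a}"]] Suc.prems(1,3)
      adjoin_gens[of "{a}" R K] subfieldE(3)[OF Suc.prems(1)] by auto
  then have "adjoin R ?K {a} = adjoin R K {a}"
    using adjoin_redundant[of "{a [^] p}" R K "{a}"] by (simp add: adjoin_adjoin)
  moreover have "a [^] p \<in> ?K" using adjoin_gens[of "{a [^] p}" R K] by simp
  ultimately show ?case using rank_step[OF k K kK Suc.prems(3) _ B'(1,2,4)] B'(3) by simp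
qed

lemma rank_mono:
  assumes "finite G" and k: "subfield k R" and K: "subfield K R" and kK: "k \<subseteq> K"
    and G: "G \<subseteq> carrier R" "\<And>g. g \<in> G \<Longrightarrow> \<exists>m::nat. g [^] (p ^ m) \<in> K"
    and B: "finite B" "B \<subseteq> K" "irredundant R (frob_field k K) B"
  shows "\<exists>B'. finite B' \<and> B' \<subseteq> adjoin R K G \<and> card B' = card B \<and>
           irredundant R (frob_field k (adjoin R K G)) B'"
  using assms(1) G
proof (induction G rule: finite_induct)
  case empty
  then show ?case using B adjoin_trivial[OF K, of "{}"] by auto
next
  case (insert g G)
  let ?K = "adjoin R K G"
  obtain B' where B': "finite B'" "B' \<subseteq> ?K" "card B' = card B" "irredundant R (frob_field k ?K) B'"
    using insert by auto
  obtain m where m: "g [^] (p ^ m) \<in> K" using insert.prems(2) by blast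
  have "subfield ?K R" "k \<subseteq> ?K" "g [^] (p ^ m) \<in> ?K"
    using insert.prems kK subfieldE(3)[OF K] m adjoin_base[of K R G]
    by (auto intro!: adjoin_subfield)
  then have "\<exists>B''. finite B'' \<and> B'' \<subseteq> adjoin R ?K {g} \<and> card B'' = card B' \<and>
           irredundant R (frob_field k (adjoin R ?K {g})) B''"
    using rank_mono_simple[OF k, of ?K g m B'] B' insert.prems by auto
  then show ?case using B'(3) by (simp add: adjoin_adjoin)
qed

text \<open>
  From \<open>b \<in> N(b\<^sup>p)\<close> the Frobenius map gives \<open>b\<^sup>p \<in> N(b\<^bsup>p^2\<^esup>)\<close> and so on, until the generator lies
  in \<open>N\<close>.
\<close>

lemma mem_of_frobenius_mem:
  assumes N: "subfield N R" and b: "b \<in> carrier R" "b [^] (p ^ m) \<in> N"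
    and mem: "b \<in> adjoin R N {b [^] p}"
  shows "b \<in> N"
proof -
  have "b \<in> adjoin R N {b [^] (p ^ j)}" for j
  proof (induction j)
    case 0
    then show ?case using b adjoin_gens[of "{b}" R N] by simp
  next
    case (Suc j)
    have "b [^] (p ^ j) \<in> adjoin R N {b [^] (p ^ Suc j)}"
      using frobenius_adjoin[OF N _ mem, of j] b by (simp add: nat_pow_pow)
    then have "adjoin R N {b [^] (p ^ j)} \<subseteq> adjoin R N {b [^] (p ^ Suc j)}"
      by (intro adjoin_least adjoin_base) simp
    then show ?case using Suc by auto
  qed
  from this[of m] show ?thesis using adjoin_trivial[OF N, of "{b [^] (p ^ m)}"] b(2) by simp
qed

text \<open>
  If \<open>f\<close> were redundant over \<open>k(k(F)\<^sup>p) = k(F\<^sup>p)\<close>, then \<open>f \<in> k(F - {f})(f\<^sup>p)\<close>, which by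
  \<open>mem_of_frobenius_mem\<close> makes it redundant over \<open>k\<close> already.
\<close>

lemma irredundant_frob_field:
  assumes k: "subfield k R" and F: "F \<subseteq> carrier R"
    and insep: "\<And>x. x \<in> F \<Longrightarrow> \<exists>m::nat. x [^] (p ^ m) \<in> k" and ir: "irredundant R k F"
  shows "irredundant R (frob_field k (adjoin R k F)) F"
  unfolding irredundant_def
proof (intro ballI notI)
  fix f assume f: "f \<in> F" and mem: "f \<in> adjoin R (frob_field k (adjoin R k F)) (F - {f})"
  let ?N = "adjoin R k (F - {f})"
  have N: "subfield ?N R"
    using F subfieldE(3)[OF k] by (intro adjoin_subfield) auto
  have fc: "f \<in> carrier R" using F f by auto
  obtain m where m: "f [^] (p ^ m) \<in> k" using insep f by blast
  have pN: "x [^] p \<in> adjoin R ?N {f [^] p}" if "x \<in> F" for x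
  proof (cases "x = f")
    case True
    then show ?thesis using adjoin_gens[of "{f [^] p}" R ?N] by simp
  next
    case False
    then have "x \<in> ?N" using that adjoin_gens[of "F - {f}" R k] by auto
    then show ?thesis using subfield_pow_closed[OF N] adjoin_base[of ?N R] by auto
  qed
  have "frob_field k (adjoin R k F) = adjoin R (frob_field k k) ((\<lambda>x. x [^] p) ` F)"
    using frob_field_adjoin[OF k k order.refl F] .
  also have "\<dots> \<subseteq> adjoin R ?N {f [^] p}"
  proof (intro adjoin_least)
    show "frob_field k k \<subseteq> adjoin R ?N {f [^] p}"
      using frob_field_subset[OF k order.refl] adjoin_base[of k R] by (auto simp: adjoin_adjoin)
    show "(\<lambda>x. x [^] p) ` F \<subseteq> adjoin R ?N {f [^] p}" using pN by auto
  qed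
  finally have "adjoin R (frob_field k (adjoin R k F)) (F - {f}) \<subseteq> adjoin R ?N {f [^] p}"
    using adjoin_gens[of "F - {f}" R k] adjoin_base[of ?N R "{f [^] p}"] by (intro adjoin_least) auto
  then have "f \<in> adjoin R ?N {f [^] p}" using mem by auto
  then have "f \<in> ?N" using mem_of_frobenius_mem[OF N fc _ ] m adjoin_base[of k R "F - {f}"] by auto
  then show False using ir f unfolding irredundant_def by simp
qed

text \<open>
  Put \<open>L = k(G)\<close>, which is also \<open>k(F)(G)\<close>. The set \<open>F\<close> is irredundant over \<open>k(k(F)\<^sup>p)\<close>, climbing to
  \<open>L\<close> yields \<open>|F|\<close> elements irredundant over \<open>k(L\<^sup>p)\<close>, and over that field the Steinitz bound by the
  generating set \<open>G\<close> is available.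
\<close>

lemma card_irredundant_le:
  assumes k: "subfield k R" and fin: "finite F" "finite G" and c: "F \<subseteq> carrier R" "G \<subseteq> carrier R"
    and insep: "\<And>x. x \<in> carrier R \<Longrightarrow> \<exists>m::nat. x [^] (p ^ m) \<in> k"
    and ir: "irredundant R k F" and FG: "F \<subseteq> adjoin R k G"
  shows "card F \<le> card G"
proof -
  let ?K = "adjoin R k F" let ?L = "adjoin R k G"
  have K: "subfield ?K R" and L: "subfield ?L R"
    using c subfieldE(3)[OF k] by (auto intro!: adjoin_subfield)
  have KL: "adjoin R ?K G = ?L" using adjoin_redundant[OF FG] by (simp add: adjoin_adjoin)
  have "\<exists>m::nat. g [^] (p ^ m) \<in> ?K" if "g \<in> G" for g
    using insep[of g] c that adjoin_base[of k R F] by auto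
  then obtain B where B: "finite B" "B \<subseteq> ?L" "card B = card F" "irredundant R (frob_field k ?L) B"
    using rank_mono[OF fin(2) k K adjoin_base c(2) _ fin(1) adjoin_gens
        irredundant_frob_field[OF k c(1) _ ir]] insep c KL by auto
  have Lc: "?L \<subseteq> carrier R" using subfieldE(3)[OF L] .
  have "card B \<le> card G"
  proof (rule steinitz[OF fin(2) _ c(2) _ B(1) _ B(4)])
    show "subfield (frob_field k ?L) R" using frob_field_subfield[OF k Lc] .
    show "B \<subseteq> carrier R" using B(2) Lc by auto
    show "x [^] p \<in> frob_field k ?L" if "x \<in> G" for x
      using that adjoin_gens[of G R k] by (intro pow_in_frob_field) auto
    have "k \<subseteq> frob_field k ?L" unfolding frob_field_def by (rule adjoin_base)
    then show "B \<subseteq> adjoin R (frob_field k ?L) G"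
      using B(2) adjoin_mono[of k "frob_field k ?L" G G R] by auto
  qed
  then show ?thesis using B(3) by simp
qed

lemma irredundant_ordLeq_finite:
  assumes k: "purely_inseparable R p (carrier R) k"
    and c: "B \<subseteq> carrier R" "C \<subseteq> carrier R" and fin: "finite C"
    and ir: "irredundant R k B" and BC: "B \<subseteq> adjoin R k C"
  shows "|B| \<le>o |C|"
proof (rule card_of_ordLeq_if_finite_subsets)
  fix F assume F: "finite F" "F \<subseteq> B"
  have sk: "subfield k R" and insep: "\<And>x. x \<in> carrier R \<Longrightarrow> \<exists>m::nat. x [^] (p ^ m) \<in> k"
    using k unfolding purely_inseparable_def by auto
  have "card F \<le> card C"
  proof (rule card_irredundant_le[OF sk F(1) fin _ c(2) insep])
    show "F \<subseteq> carrier R" "F \<subseteq> adjoin R k C" using F(2) c(1) BC by auto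
    show "irredundant R k F" using irredundant_subset[OF ir F(2)] .
  qed
  then show "|F| \<le>o |C|" using card_of_ordLeq_iff_card[OF F(1) fin] by simp
qed (simp_all add: fin)

text \<open>
  For infinite \<open>C\<close>, the set \<open>B\<close> is the union of its intersections with \<open>k(F)\<close> for finite
  \<open>F \<subseteq> C\<close>; each of them is finite, and there are only \<open>|C|\<close> many \<open>F\<close>.
\<close>

lemma irredundant_ordLeq:
  assumes k: "purely_inseparable R p (carrier R) k"
    and c: "B \<subseteq> carrier R" "C \<subseteq> carrier R"
    and ir: "irredundant R k B" and BC: "B \<subseteq> adjoin R k C"
  shows "|B| \<le>o |C|"
proof (cases "finite C")
  case True
  then show ?thesis using irredundant_ordLeq_finite assms by blast
next
  case False
  have "|B \<inter> adjoin R k F| \<le>o |C|" if F: "F \<in> Fpow C" for F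
  proof -
    have F': "finite F" "F \<subseteq> C" using F by (auto simp: Fpow_def)
    have "|B \<inter> adjoin R k F| \<le>o |F|"
      using c F' irredundant_subset[OF ir, of "B \<inter> adjoin R k F"]
      by (intro irredundant_ordLeq_finite[OF k]) auto
    then show ?thesis using card_of_mono1[OF F'(2)] ordLeq_transitive by blast
  qed
  then have "|\<Union>F\<in>Fpow C. B \<inter> adjoin R k F| \<le>o |C|"
    using False ordIso_imp_ordLeq[OF card_of_Fpow_infinite[OF False]]
    by (intro card_of_UNION_ordLeq_infinite) auto
  moreover have "B = (\<Union>F\<in>Fpow C. B \<inter> adjoin R k F)"
  proof -
    have "\<exists>F\<in>Fpow C. b \<in> adjoin R k F" if "b \<in> B" for b
    proof -
      have "b \<in> adjoin R k C" using BC that by auto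
      then obtain F where "finite F" "F \<subseteq> C" "b \<in> adjoin R k F" by (rule adjoin_finitary)
      then show ?thesis by (intro bexI[of _ F]) (simp_all add: Fpow_def)
    qed
    then show ?thesis by auto
  qed
  ultimately show ?thesis by simp
qed

section \<open>Existence of \<open>r\<close>-bases and bounded exponent\<close>

text \<open>
  A maximal irredundant set over \<open>k(K\<^sup>p)\<close> exists by Zorn's lemma because redundancy is witnessed by
  finitely many elements, and it generates \<open>K\<close> because an element outside the generated field could
  be added.
\<close>

lemma r_base_exists:
  assumes k: "subfield k R" and K: "subfield K R" and kK: "k \<subseteq> K"
  shows "\<exists>B. r_base R p K k B"
proof -
  let ?M = "frob_field k K" let ?A = "{B. B \<subseteq> K \<and> irredundant R (frob_field k K) B}"
  have Kc: "K \<subseteq> carrier R" using subfieldE(3)[OF K] .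
  have M: "subfield ?M R" using frob_field_subfield[OF k Kc] .
  have MK: "?M \<subseteq> K" using frob_field_subset[OF K kK] .
  have "\<exists>B\<in>?A. \<forall>Y\<in>?A. B \<subseteq> Y \<longrightarrow> Y = B"
  proof (rule subset_Zorn_nonempty)
    show "?A \<noteq> {}" by (auto simp: irredundant_def intro: exI[of _ "{}"])
    fix C assume C: "C \<noteq> {}" "subset.chain ?A C"
    have CA: "Y \<in> ?A" if "Y \<in> C" for Y using C(2) that by (auto simp: subset.chain_def)
    have "irredundant R ?M (\<Union>C)"
      unfolding irredundant_def
    proof (intro ballI notI)
      fix b assume b: "b \<in> \<Union>C" "b \<in> adjoin R ?M (\<Union>C - {b})"
      obtain F where F: "finite F" "F \<subseteq> \<Union>C - {b}" "b \<in> adjoin R ?M F"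
        using adjoin_finitary[OF b(2)] .
      have "finite (insert b F)" "insert b F \<subseteq> \<Union>C" using F b(1) by auto
      then obtain Y where Y: "Y \<in> C" "insert b F \<subseteq> Y"
        using finite_subset_Union_chain[OF _ _ C] by metis
      then have "F \<subseteq> Y - {b}" using F(2) by auto
      then have "b \<in> adjoin R ?M (Y - {b})"
        using F(3) adjoin_mono[OF order.refl, of F "Y - {b}" R ?M] by auto
      then show False using CA[OF Y(1)] Y(2) unfolding irredundant_def by auto
    qed
    then show "\<Union>C \<in> ?A" using CA by auto
  qed
  then obtain B where B: "B \<subseteq> K" "irredundant R ?M B"
    and max: "\<And>Y. Y \<subseteq> K \<Longrightarrow> irredundant R ?M Y \<Longrightarrow> B \<subseteq> Y \<Longrightarrow> Y = B" by auto
  have "K \<subseteq> adjoin R ?M B"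
  proof
    fix x assume x: "x \<in> K"
    show "x \<in> adjoin R ?M B"
    proof (rule ccontr)
      assume nx: "x \<notin> adjoin R ?M B"
      have "irredundant R ?M (insert x B)"
        using irredundant_insert[OF M _ B(2) _ pow_in_frob_field[OF x] nx] B(1) x Kc by auto
      then have "insert x B = B" using max[of "insert x B"] x B(1) by auto
      then show False using nx adjoin_gens[of B R ?M] by auto
    qed
  qed
  moreover have "adjoin R ?M B \<subseteq> K" using adjoin_le_subfield[OF K MK B(1)] .
  ultimately show ?thesis
    using B unfolding r_base_def r_span_eq irredundant_def by auto
qed

lemma root_field_subfield:
  assumes "subfield k R" "subfield K R"
  shows "subfield (root_field R p K k n) R"
proof -
  have "root_field R p K k n = K \<inter> {x \<in> carrier R. x [^] (p ^ n) \<in> k}"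
    unfolding root_field_def by (auto dest: subsetD[OF subfieldE(3)[OF assms(2)]])
  then show ?thesis using subfield_Int[OF subfield_frobenius_vimage assms(2)] assms(1) by simp
qed

lemma base_subset_root_field:
  assumes "subfield k R" "k \<subseteq> K"
  shows "k \<subseteq> root_field R p K k n"
  using assms subfield_pow_closed unfolding root_field_def by auto

lemma incseq_root_field:
  assumes "subfield k R" "subfield K R"
  shows "incseq (root_field R p K k)"
proof (rule incseq_SucI)
  fix n
  have "x [^] (p ^ Suc n) \<in> k" if "x \<in> carrier R" "x [^] (p ^ n) \<in> k" for x
    using subfield_pow_closed[OF assms(1) that(2), of p] that(1) by (simp add: nat_pow_pow mult.commute)
  then show "root_field R p K k n \<subseteq> root_field R p K k (Suc n)"
    using subfieldE(3)[OF assms(2)] unfolding root_field_def by auto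
qed

lemma UN_root_field:
  assumes "purely_inseparable R p (carrier R) k" "subfield K R"
  shows "(\<Union>n. root_field R p K k n) = K"
proof -
  have "\<exists>n. x [^] (p ^ n) \<in> k" if "x \<in> K" for x
    using assms(1) subsetD[OF subfieldE(3)[OF assms(2)] that] unfolding purely_inseparable_def by blast
  then show ?thesis unfolding root_field_def by auto
qed

text \<open>
  Substituting \<open>K = k(K\<^sup>p)(B)\<close> into itself gives \<open>K = k(B \<union> K\<^bsup>p^j\<^esup>)\<close> for every \<open>j\<close>, and
  \<open>K\<^bsup>p^n\<^esup> \<subseteq> k\<close>.
\<close>

lemma r_base_bounded_exponent:
  assumes k: "subfield k R" and K: "subfield K R" and kK: "k \<subseteq> K"
    and exp: "\<And>x. x \<in> K \<Longrightarrow> x [^] (p ^ n) \<in> k" and B: "r_base R p K k B"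
  shows "B \<subseteq> K" and "irredundant R k B" and "adjoin R k B = K"
proof -
  have Kc: "K \<subseteq> carrier R" using subfieldE(3)[OF K] .
  show BK: "B \<subseteq> K" using B unfolding r_base_def by simp
  have eq: "K = adjoin R (frob_field k K) B" using B unfolding r_base_def r_span_eq by simp
  have "irredundant R (frob_field k K) B" using B unfolding r_base_def r_span_eq irredundant_def by simp
  moreover have "k \<subseteq> frob_field k K" unfolding frob_field_def by (rule adjoin_base)
  ultimately show "irredundant R k B"
    unfolding irredundant_def using adjoin_mono[OF _ order.refl, of k "frob_field k K"] by blast
  let ?p = "\<lambda>j x. x [^] (p ^ j)"
  have step: "K \<subseteq> adjoin R k (B \<union> ?p j ` K)" for j
  proof (induction j)
    case 0
    have "?p 0 ` K = K" using Kc by (auto simp: subset_iff image_iff)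
    then show ?case using adjoin_gens[of "B \<union> ?p 0 ` K" R k] by auto
  next
    case (Suc j)
    let ?L = "adjoin R k (B \<union> ?p (Suc j) ` K)"
    have sL: "subfield ?L R" using subfieldE(3)[OF k] BK Kc by (intro adjoin_subfield) auto
    have gB: "B \<subseteq> ?L" and gK: "?p (Suc j) ` K \<subseteq> ?L"
      using adjoin_gens[of "B \<union> ?p (Suc j) ` K" R k] by auto
    have "?p j x \<in> ?L" if x: "x \<in> K" for x
    proof -
      have "x \<in> adjoin R k (?p 1 ` K \<union> B)"
        using x eq unfolding frob_field_def adjoin_adjoin by simp
      then have "?p j x \<in> adjoin R k (?p j ` (?p 1 ` K \<union> B))"
        using Kc BK by (intro frobenius_adjoin k) auto
      also have "\<dots> \<subseteq> ?L"
      proof (intro adjoin_least adjoin_base)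
        have "?p j (?p 1 y) = ?p (Suc j) y" if "y \<in> K" for y
          using that Kc by (simp add: nat_pow_pow subset_iff)
        then show "?p j ` (?p 1 ` K \<union> B) \<subseteq> ?L"
          using gB gK subfield_pow_closed[OF sL] by auto
      qed
      finally show ?thesis .
    qed
    then have "adjoin R k (B \<union> ?p j ` K) \<subseteq> ?L"
      using gB by (intro adjoin_least adjoin_base) auto
    then show ?case using Suc by auto
  qed
  have "adjoin R k (B \<union> ?p n ` K) \<subseteq> adjoin R k B"
    using exp adjoin_base[of k R B] adjoin_gens[of B R k] by (intro adjoin_least) auto
  then have "K \<subseteq> adjoin R k B" using step[of n] by auto
  moreover have "adjoin R k B \<subseteq> K" using adjoin_le_subfield[OF K kK BK] .
  ultimately show "adjoin R k B = K" by auto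
qed

section \<open>The degree of irrationality as a supremum over irredundant sets\<close>

definition root_base :: "'a set \<Rightarrow> 'a set \<Rightarrow> nat \<Rightarrow> 'a set" where
  "root_base K k n = (SOME B. r_base R p (root_field R p K k n) k B)"

lemma di_eq: "di R p K k = card_Sup {|root_base K k n| | n. 1 \<le> n}"
  by (simp add: di_def root_base_def)

lemma root_base:
  assumes k: "subfield k R" and K: "subfield K R" and kK: "k \<subseteq> K"
  shows "root_base K k n \<subseteq> root_field R p K k n" and "irredundant R k (root_base K k n)"
    and "adjoin R k (root_base K k n) = root_field R p K k n"
proof -
  have rf: "subfield (root_field R p K k n) R" "k \<subseteq> root_field R p K k n"
    using root_field_subfield[OF k K] base_subset_root_field[OF k kK] .
  have "r_base R p (root_field R p K k n) k (root_base K k n)"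
    unfolding root_base_def using someI_ex[OF r_base_exists[OF k rf]] .
  note * = r_base_bounded_exponent[OF k rf _ this, of n]
  show "root_base K k n \<subseteq> root_field R p K k n" "irredundant R k (root_base K k n)"
    "adjoin R k (root_base K k n) = root_field R p K k n"
    by (rule *; simp add: root_field_def)+
qed

lemma Card_order_di: "Card_order (di R p K k)"
  unfolding di_eq by (intro card_Sup(1)) auto

lemma root_base_ordLeq_di:
  assumes "1 \<le> n" shows "|root_base K k n| \<le>o di R p K k"
  unfolding di_eq using assms by (intro card_Sup(2)) auto

text \<open>
  The level \<open>n = 0\<close>, which the definition of \<open>di\<close> leaves out, is covered by passing to level \<open>n + 1\<close>.
\<close>

lemma irredundant_ordLeq_di:
  assumes k: "purely_inseparable R p (carrier R) k" and K: "subfield K R" and kK: "k \<subseteq> K"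
    and B: "irredundant R k B" "B \<subseteq> root_field R p K k n"
  shows "|B| \<le>o di R p K k"
proof -
  have sk: "subfield k R" using k unfolding purely_inseparable_def by simp
  have Kc: "K \<subseteq> carrier R" using subfieldE(3)[OF K] .
  have rK: "root_field R p K k m \<subseteq> K" for m unfolding root_field_def by auto
  have "B \<subseteq> adjoin R k (root_base K k (Suc n))"
    using B(2) incseqD[OF incseq_root_field[OF sk K], of n "Suc n"] root_base(3)[OF sk K kK] by auto
  moreover have "B \<subseteq> carrier R" "root_base K k (Suc n) \<subseteq> carrier R"
    using B(2) root_base(1)[OF sk K kK, of "Suc n"] rK Kc by blast+
  ultimately have "|B| \<le>o |root_base K k (Suc n)|"
    using irredundant_ordLeq[OF k _ _ B(1)] by simp
  then show ?thesis using root_base_ordLeq_di[of "Suc n" K k] ordLeq_transitive by auto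
qed

text \<open>
  Together with \<open>irredundant_ordLeq_di\<close> this replaces the chosen \<open>r\<close>-bases in the definition of \<open>di\<close>
  by all irredundant subsets of the root fields.
\<close>

lemma di_ordLeq:
  fixes r :: "'c rel"
  assumes k: "subfield k R" and K: "subfield K R" and kK: "k \<subseteq> K" and r: "Card_order r"
    and le: "\<And>B n. irredundant R k B \<Longrightarrow> B \<subseteq> root_field R p K k n \<Longrightarrow> |B| \<le>o r"
  shows "di R p K k \<le>o r"
proof -
  have "|root_base K k n| \<le>o r" for n using le[OF root_base(2,1)[OF k K kK]] .
  then show ?thesis unfolding di_eq using r by (intro card_Sup(3)) auto
qed

end

section \<open>Linear disjointness and adjunction\<close>

context field
begin

lemma combine_in_subring:
  assumes "subring E R" "set Ks \<subseteq> E" "set Us \<subseteq> E"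
  shows "combine Ks Us \<in> E"
  using assms(2,3) subringE(2,6,7)[OF assms(1)] by (induction Ks Us rule: combine.induct) auto

lemma subfield_of_integral_subring:
  assumes E: "subring E R" and k: "subfield k R" "k \<subseteq> E"
    and insep: "\<And>x. x \<in> E \<Longrightarrow> \<exists>n::nat. x [^] Suc n \<in> k"
  shows "subfield E R"
proof (rule subfieldI'[OF E])
  fix x assume x: "x \<in> E - {\<zero>}"
  have xc: "x \<in> carrier R" "x \<noteq> \<zero>" using x subringE(1)[OF E] by auto
  obtain n where n: "x [^] Suc n \<in> k" using insep x by blast
  have nz: "x [^] m \<noteq> \<zero>" for m :: nat using xc by (induction m) (auto simp: integral_iff)
  have pw: "x [^] m \<in> E" for m :: nat
    using x subringE(3,6)[OF E] by (induction m) auto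
  let ?y = "x [^] Suc n"
  have y: "?y \<in> Units R" using nz[of "Suc n"] xc by (simp only: field_Units nat_pow_closed) simp
  have iy: "inv ?y \<in> E" using subfield_m_inv(1)[OF k(1), of ?y] n nz[of "Suc n"] k(2) by blast
  have "x \<otimes> (x [^] n \<otimes> inv ?y) = ?y \<otimes> inv ?y"
    using xc y Units_inv_closed[OF y] m_comm[of x "x [^] n"] by (simp add: m_assoc[symmetric])
  also have "\<dots> = \<one>" using y by simp
  finally have "inv x = x [^] n \<otimes> inv ?y"
    using xc Units_inv_closed[OF y] by (intro comm_inv_char) auto
  then show "inv x \<in> E" using pw[of n] iy subringE(6)[OF E] by simp
qed

text \<open>
  The sums of products \<open>l m\<close> form a ring that contains \<open>L\<close> and \<open>M\<close>. As a positive power of each of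
  its elements lies in \<open>k\<close>, it is a field.
\<close>

lemma adjoin_combine:
  assumes k: "subfield k R" and L: "subfield L R" "k \<subseteq> L" and M: "subfield M R"
    and insep: "\<And>x. x \<in> carrier R \<Longrightarrow> \<exists>n::nat. x [^] Suc n \<in> k"
    and x: "x \<in> adjoin R L M"
  obtains Ks Us where "set Ks \<subseteq> L" "set Us \<subseteq> M" "x = combine Ks Us"
proof -
  define E where "E = {combine Ks Us | Ks Us. length Ks = length Us \<and> set Ks \<subseteq> L \<and> set Us \<subseteq> M}"
  have Lc: "L \<subseteq> carrier R" and Mc: "M \<subseteq> carrier R" using subfieldE(3) L(1) M by auto
  note sL = subringE[OF subfieldE(1)[OF L(1)]] and sM = subringE[OF subfieldE(1)[OF M]]
  have add: "a \<oplus> b \<in> E" if ab: "a \<in> E" "b \<in> E" for a b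
  proof -
    obtain Ks Us Ks' Us' where *: "length Ks = length Us" "set Ks \<subseteq> L" "set Us \<subseteq> M" "a = combine Ks Us"
      "length Ks' = length Us'" "set Ks' \<subseteq> L" "set Us' \<subseteq> M" "b = combine Ks' Us'"
      using ab unfolding E_def by blast
    have "a \<oplus> b = combine (Ks @ Ks') (Us @ Us')"
      using * combine_append[of Ks Us Ks' Us'] Lc Mc by (meson subset_trans)
    then show ?thesis
      unfolding E_def using * by (intro CollectI exI[of _ "Ks @ Ks'"] exI[of _ "Us @ Us'"]) simp
  qed
  have left: "c \<otimes> a \<in> E" if c: "c \<in> L" and a: "a \<in> E" for c a
  proof -
    obtain Ks Us where *: "length Ks = length Us" "set Ks \<subseteq> L" "set Us \<subseteq> M" "a = combine Ks Us"
      using a unfolding E_def by blast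
    have "c \<otimes> a = combine (map ((\<otimes>) c) Ks) Us"
      unfolding *(4) using * c Lc Mc by (intro combine_r_distr) auto
    moreover have "set (map ((\<otimes>) c) Ks) \<subseteq> L" using c *(2) sL(6) by auto
    ultimately show ?thesis
      unfolding E_def using * by (intro CollectI exI[of _ "map ((\<otimes>) c) Ks"] exI[of _ Us]) simp
  qed
  have right: "a \<otimes> u \<in> E" if u: "u \<in> M" and a: "a \<in> E" for u a
  proof -
    obtain Ks Us where *: "length Ks = length Us" "set Ks \<subseteq> L" "set Us \<subseteq> M" "a = combine Ks Us"
      using a unfolding E_def by blast
    have "a \<otimes> u = combine Ks (map (\<lambda>u'. u' \<otimes> u) Us)"
      unfolding *(4) using * u Lc Mc by (intro combine_l_distr) auto
    moreover have "set (map (\<lambda>u'. u' \<otimes> u) Us) \<subseteq> M" using u *(3) sM(6) by auto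
    ultimately show ?thesis
      unfolding E_def using * by (intro CollectI exI[of _ Ks] exI[of _ "map (\<lambda>u'. u' \<otimes> u) Us"]) simp
  qed
  have zero: "\<zero> \<in> E" unfolding E_def by (intro CollectI exI[of _ "[]"]) simp
  have Ec: "E \<subseteq> carrier R" unfolding E_def using Lc Mc by (auto intro!: combine_in_carrier)
  have one: "\<one> \<in> E"
    unfolding E_def using sL(3) sM(3) by (intro CollectI exI[of _ "[\<one>]"]) simp
  have mult: "combine Ks Us \<otimes> b \<in> E" if "set Ks \<subseteq> L" "set Us \<subseteq> M" and b: "b \<in> E" for Ks Us b
    using that(1,2)
  proof (induction Ks Us rule: combine.induct)
    case (1 k Ks u Us)
    then have ku: "k \<in> L" "u \<in> M" and IH: "combine Ks Us \<otimes> b \<in> E" by auto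
    have c: "k \<in> carrier R" "u \<in> carrier R" "combine Ks Us \<in> carrier R" "b \<in> carrier R"
      using 1 Lc Mc b Ec by (auto intro!: combine_in_carrier)
    have "combine (k # Ks) (u # Us) \<otimes> b = k \<otimes> (b \<otimes> u) \<oplus> combine Ks Us \<otimes> b"
      using c by (simp add: l_distr r_distr m_ac)
    then show ?case using add[OF left[OF ku(1) right[OF ku(2) b]] IH] by simp
  qed (use b Ec zero in auto)
  have sE: "subring E R"
  proof (rule subringI)
    fix a b assume a: "a \<in> E" and b: "b \<in> E"
    have "\<ominus> a = (\<ominus> \<one>) \<otimes> a" using a Ec by (auto simp: l_minus)
    then show "\<ominus> a \<in> E" using left[OF _ a, of "\<ominus> \<one>"] sL(3,5) by simp
    show "a \<otimes> b \<in> E" using a mult[OF _ _ b] unfolding E_def by auto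
    show "a \<oplus> b \<in> E" using add a b .
  qed (use one Ec in auto)
  have LE: "L \<subseteq> E" using left[OF _ one] Lc by force
  have ME: "M \<subseteq> E" using right[OF _ one] Mc by force
  have "subfield E R"
    using L(2) LE insep Ec by (intro subfield_of_integral_subring[OF sE k]) auto
  then have "x \<in> E" using adjoin_le_subfield[OF _ LE ME] x by auto
  then show thesis using that unfolding E_def by auto
qed

lemma Span_mono_field:
  assumes k: "subfield k R" and L: "subfield L R" "k \<subseteq> L" and Us: "set Us \<subseteq> carrier R"
  shows "Span k Us \<subseteq> Span L Us"
  unfolding Span_eq_combine_set[OF k Us] Span_eq_combine_set[OF L(1) Us] using L(2) by blast

text \<open>
  Otherwise \<open>b\<close> is independent over \<open>k\<close> of a \<open>k\<close>-independent list \<open>Vs\<close> in \<open>k(S)\<close>, chosen so that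
  \<open>b\<close> lies in the \<open>L\<close>-span of \<open>Vs\<close>. All these elements belong to \<open>K\<close>, so linear disjointness makes
  them independent over \<open>L\<close>, a contradiction.
\<close>

lemma linearly_disjoint_descent:
  assumes k: "subfield k R" and K: "subfield K R" "k \<subseteq> K" and L: "subfield L R" "k \<subseteq> L"
    and insep: "\<And>x. x \<in> carrier R \<Longrightarrow> \<exists>n::nat. x [^] Suc n \<in> k"
    and ld: "linearly_disjoint R k K L"
    and S: "S \<subseteq> K" and b: "b \<in> K" "b \<in> adjoin R L S"
  shows "b \<in> adjoin R k S"
proof (rule ccontr)
  let ?M = "adjoin R k S"
  assume nb: "b \<notin> ?M"
  have Kc: "K \<subseteq> carrier R" using subfieldE(3)[OF K(1)] .
  have MK: "?M \<subseteq> K" using adjoin_le_subfield[OF K S] .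
  have M: "subfield ?M R" using S Kc subfieldE(3)[OF k] by (intro adjoin_subfield) auto
  have "b \<in> adjoin R L ?M" using b(2) adjoin_mono[OF order.refl adjoin_gens[of S R k], of R L] by auto
  then obtain Ks Us where KU: "set Ks \<subseteq> L" "set Us \<subseteq> ?M" "b = combine Ks Us"
    using adjoin_combine[OF k L M insep] by metis
  have Uc: "set Us \<subseteq> carrier R" using KU(2) MK Kc by blast
  obtain Vs where Vs: "set Vs \<subseteq> carrier R" "independent k Vs" "Span k Vs = Span k Us"
    using filter_base[OF k Uc] .
  have SM: "Span k Us \<subseteq> ?M"
    unfolding Span_eq_combine_set[OF k Uc]
    using combine_in_subring[OF subfieldE(1)[OF M] _ KU(2)] adjoin_base[of k R S] by blast
  have VM: "set Vs \<subseteq> ?M" using Span_base_incl[OF k Vs(1)] Vs(3) SM by blast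
  have "b \<notin> Span k Vs" using nb SM Vs(3) by auto
  then have "independent k (b # Vs)" using Vs(2) b(1) Kc by (intro li_Cons) auto
  moreover have "set (b # Vs) \<subseteq> K" using VM MK b(1) by auto
  ultimately have "independent L (b # Vs)" using ld unfolding linearly_disjoint_def by blast
  then have "b \<notin> Span L Vs" by (rule independent_backwards)
  moreover have "Span L Us \<subseteq> Span L Vs"
    using Span_base_incl[OF k Uc] Vs(3) Span_mono_field[OF k L Vs(1)]
    by (intro mono_Span_subset[OF L(1) _ Vs(1)]) auto
  moreover have "b \<in> Span L Us" unfolding Span_eq_combine_set[OF L(1) Uc] using KU by blast
  ultimately show False by auto
qed

text \<open>
  With \<open>M = k(S)\<close>, the element \<open>b\<close> is an \<open>M\<close>-combination of elements of \<open>K\<close>, hence of a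
  \<open>k\<close>-independent list in \<open>K\<close> that contains \<open>1\<close>. That list is independent over \<open>L\<close>, so the expansion agrees with \<open>b = b 1\<close>
  and \<open>b\<close> is one of its coefficients in \<open>M\<close>.
\<close>

lemma linearly_disjoint_descent_sym:
  assumes k: "subfield k R" and K: "subfield K R" "k \<subseteq> K" and L: "subfield L R" "k \<subseteq> L"
    and insep: "\<And>x. x \<in> carrier R \<Longrightarrow> \<exists>n::nat. x [^] Suc n \<in> k"
    and ld: "linearly_disjoint R k K L"
    and S: "S \<subseteq> L" and b: "b \<in> L" "b \<in> adjoin R K S"
  shows "b \<in> adjoin R k S"
proof -
  let ?M = "adjoin R k S"
  have Kc: "K \<subseteq> carrier R" and Lc: "L \<subseteq> carrier R"
    using subfieldE(3)[OF K(1)] subfieldE(3)[OF L(1)] .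
  have M_le: "?M \<subseteq> L" using adjoin_le_subfield[OF L S] .
  have M: "subfield ?M R" using S Lc subfieldE(3)[OF k] by (intro adjoin_subfield) auto
  have kM: "k \<subseteq> ?M" by (rule adjoin_base)
  have "adjoin R K S \<subseteq> adjoin R ?M K"
    using adjoin_gens[of S R k] adjoin_base[of ?M R K] adjoin_gens[of K R ?M]
    by (intro adjoin_least) auto
  then have "b \<in> adjoin R ?M K" using b(2) by auto
  then obtain Ks Us where KU: "set Ks \<subseteq> ?M" "set Us \<subseteq> K" "b = combine Ks Us"
    using adjoin_combine[OF k M kM K(1) insep] by metis
  have Uc: "set Us \<subseteq> carrier R" using KU(2) Kc by blast
  let ?E = "Span k (\<one> # Us)"
  have U1: "set (\<one> # Us) \<subseteq> carrier R" using Uc by simp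
  have "\<one> \<in> K" using subringE(3)[OF subfieldE(1)[OF K(1)]] .
  then have "set (\<one> # Us) \<subseteq> K" using KU(2) by simp
  then have EK: "?E \<subseteq> K"
    unfolding Span_eq_combine_set[OF k U1]
    using combine_in_subring[OF subfieldE(1)[OF K(1)] _ _] K(2) by blast
  obtain Vs where Vs: "set Vs \<subseteq> carrier R" "independent k Vs" "Span k Vs = ?E"
    using filter_base[OF k U1] .
  have "independent k [\<one>]" by (rule li_Cons) auto
  moreover have UE: "set (\<one> # Us) \<subseteq> ?E" using Span_base_incl[OF k U1] .
  ultimately obtain Ws where W: "independent k (Ws @ [\<one>])" "Span k (Ws @ [\<one>]) = ?E"
    using complete_base[OF k dimensionI[OF k Vs(2,3)], of "[\<one>]"] by auto
  let ?W = "Ws @ [\<one>]"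
  have Wc: "set ?W \<subseteq> carrier R" using independent_in_carrier[OF W(1)] .
  have WK: "set ?W \<subseteq> K" using Span_base_incl[OF k Wc] W(2) EK by blast
  have ind: "independent L ?W" using ld W(1) WK unfolding linearly_disjoint_def by blast
  have "set Us \<subseteq> Span ?M ?W"
    using UE W(2) Span_mono_field[OF k M kM Wc] by auto
  then have "Span ?M Us \<subseteq> Span ?M ?W" using Wc by (intro mono_Span_subset[OF M])
  moreover have "b \<in> Span ?M Us" unfolding Span_eq_combine_set[OF M Uc] using KU by blast
  ultimately have "b \<in> Span ?M ?W" by blast
  then obtain Cs where Cs: "set Cs \<subseteq> ?M" "length Cs = length ?W" "b = combine Cs ?W"
    using Span_mem_iff_length_version[OF M Wc] by blast
  \<comment> \<open>the expansion \<open>b = b 1\<close>, as \<open>1\<close> is the last element of the list\<close>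
  let ?Ds = "replicate (length Ws) \<zero> @ [b]"
  have bc: "b \<in> carrier R" using b(1) Lc by auto
  have Ds: "b = combine ?Ds ?W"
    using combine_prepend_replicate[of "[b]" ?W "length Ws"] bc Wc by simp
  have DsL: "set ?Ds \<subseteq> L" using b(1) subringE(2)[OF subfieldE(1)[OF L(1)]] by auto
  have CsL: "set Cs \<subseteq> L" using Cs(1) M_le by blast
  have "b \<in> Span L ?W"
    using Span_mem_iff_length_version[OF L(1) Wc, of b] Cs(2,3) CsL by blast
  from unique_decomposition[OF L(1) ind this]
  have "Cs = ?Ds" using Cs(2,3) CsL Ds DsL by (metis length_append length_replicate length_Cons list.size(3))
  then have "b \<in> set Cs" by (metis in_set_conv_decomp)
  then show ?thesis using Cs(1) by auto
qed

end

section \<open>The compositum\<close>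

context char_p_field
begin

lemma insepD:
  assumes "purely_inseparable R p (carrier R) k" "x \<in> carrier R"
  shows "\<exists>n::nat. x [^] Suc n \<in> k"
proof -
  obtain m where "x [^] (p ^ m) \<in> k" using assms unfolding purely_inseparable_def by blast
  then show ?thesis using prime_gt_0_nat[OF prime_p] by (metis Suc_pred zero_less_power)
qed

lemma purely_inseparable_intermediate:
  assumes "purely_inseparable R p (carrier R) k" "subfield L R" "k \<subseteq> L"
  shows "purely_inseparable R p (carrier R) L"
  using assms subfieldE(3)[OF assms(2)] unfolding purely_inseparable_def by blast

text \<open>
  \<open>A\<close> and \<open>C\<close> generate the same fields: \<open>A\<close> is increasing, which the chosen \<open>r\<close>-bases in \<open>C\<close>
  need not be, while \<open>C\<close> carries the bound on the number of generators.
\<close>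

lemma irredundant_ordLeq_increasing:
  fixes A C :: "nat \<Rightarrow> 'a set" and r :: "'c rel"
  assumes l: "purely_inseparable R p (carrier R) l" and B: "B \<subseteq> carrier R" "irredundant R l B"
    and A: "incseq A" "B \<subseteq> adjoin R l (\<Union>n. A n)"
    and C: "\<And>n. C n \<subseteq> carrier R" "\<And>n. C n \<subseteq> A n" "\<And>n. A n \<subseteq> adjoin R l (C n)"
    and r: "Card_order r" "\<And>n. |C n| \<le>o r"
  shows "|B| \<le>o r"
proof -
  have AC: "adjoin R l (A n) = adjoin R l (C n)" for n
    using adjoin_redundant[OF C(3)[of n]] C(2)[of n] by (simp add: Un_absorb2)
  have "|B \<inter> adjoin R l (A n)| \<le>o r" for n
  proof -
    have "|B \<inter> adjoin R l (A n)| \<le>o |C n|"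
      unfolding AC using B C(1) irredundant_subset[OF B(2), of "B \<inter> adjoin R l (C n)"]
      by (intro irredundant_ordLeq[OF l]) auto
    then show ?thesis using r(2) ordLeq_transitive by blast
  qed
  moreover have "incseq (\<lambda>n. B \<inter> adjoin R l (A n))"
  proof (rule incseq_SucI)
    show "B \<inter> adjoin R l (A n) \<subseteq> B \<inter> adjoin R l (A (Suc n))" for n
      using adjoin_mono[OF order.refl incseq_SucD[OF A(1)], of R l n] by auto
  qed
  ultimately have "|\<Union>n. B \<inter> adjoin R l (A n)| \<le>o r"
    by (intro card_of_incseq_UN_ordLeq[OF r(1)])
  moreover have "(\<Union>n. B \<inter> adjoin R l (A n)) = B"
  proof -
    have "\<exists>n. b \<in> adjoin R l (A n)" if "b \<in> B" for b
      using adjoin_incseq_UN[OF A(1) subsetD[OF A(2) that]] by metis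
    then show ?thesis by auto
  qed
  ultimately show ?thesis by simp
qed

lemma UN_root_field_Suc:
  assumes "purely_inseparable R p (carrier R) k" "subfield K R"
  shows "(\<Union>n. root_field R p K k (Suc n)) = K"
proof -
  have "subfield k R" using assms(1) unfolding purely_inseparable_def by simp
  then have "root_field R p K k n \<subseteq> root_field R p K k (Suc n)" for n
    using incseq_SucD[OF incseq_root_field[OF _ assms(2)]] by blast
  then have "(\<Union>n. root_field R p K k n) \<subseteq> (\<Union>n. root_field R p K k (Suc n))"
    by (intro UN_mono) auto
  then show ?thesis using UN_root_field[OF assms] by (auto simp: root_field_def)
qed

context
  fixes k K L :: "'a set"
  assumes k: "purely_inseparable R p (carrier R) k"
    and K: "subfield K R" "k \<subseteq> K" and L: "subfield L R" "k \<subseteq> L"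
begin

lemma ground_subfield: "subfield k R" using k unfolding purely_inseparable_def by simp

lemma left_factor_in_carrier: "K \<subseteq> carrier R" and right_factor_in_carrier: "L \<subseteq> carrier R"
  using subfieldE(3)[OF K(1)] subfieldE(3)[OF L(1)] .

lemma compositum_subfield: "subfield (compositum R K L) R"
  unfolding compositum_def using left_factor_in_carrier right_factor_in_carrier by (intro generate_field_is_subfield) auto

lemma compositum_supset: "K \<subseteq> compositum R K L" "L \<subseteq> compositum R K L" "k \<subseteq> compositum R K L"
  unfolding compositum_def using K(2) by (auto intro: generate_field.incl)

lemma irredundant_over_compositum_factor:
  assumes ld: "linearly_disjoint R k K L" and B: "B \<subseteq> K" "irredundant R k B"
  shows "irredundant R L B"
  unfolding irredundant_def
proof (intro ballI notI)
  fix b assume b: "b \<in> B" "b \<in> adjoin R L (B - {b})"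
  have "b \<in> adjoin R k (B - {b})"
    using linearly_disjoint_descent[OF ground_subfield K L insepD[OF k] ld _ _ b(2)] B(1) b(1) by auto
  then show False using B(2) b(1) unfolding irredundant_def by simp
qed

text \<open>
  A redundant \<open>b \<in> B\<close> would lie in \<open>L(B - {b})\<close>, hence in \<open>k(B - {b})\<close> by descent; similarly for
  \<open>C\<close> with \<open>K\<close> in place of \<open>L\<close>. A common element of \<open>B\<close> and \<open>C\<close> would lie in \<open>L\<close> already.
\<close>

lemma irredundant_Un:
  assumes ld: "linearly_disjoint R k K L"
    and B: "B \<subseteq> K" "irredundant R k B" and C: "C \<subseteq> L" "irredundant R k C"
  shows "irredundant R k (B \<union> C)" and "B \<inter> C = {}"
proof -
  have nB: "b \<notin> adjoin R L (B - {b})" if "b \<in> B" for b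
    using irredundant_over_compositum_factor[OF ld B] that unfolding irredundant_def by simp
  have nC: "c \<notin> adjoin R K (C - {c})" if c: "c \<in> C" for c
  proof
    assume c': "c \<in> adjoin R K (C - {c})"
    have "c \<in> adjoin R k (C - {c})"
      using linearly_disjoint_descent_sym[OF ground_subfield K L insepD[OF k] ld _ _ c'] C(1) c by auto
    then show False using C(2) c unfolding irredundant_def by simp
  qed
  show disj: "B \<inter> C = {}"
  proof (rule equals0I)
    fix b assume "b \<in> B \<inter> C"
    then show False using nB[of b] C(1) adjoin_base[of L R "B - {b}"] by auto
  qed
  show "irredundant R k (B \<union> C)"
    unfolding irredundant_def
  proof
    fix b assume "b \<in> B \<union> C"
    then consider "b \<in> B" | "b \<in> C" by blast
    then show "b \<notin> adjoin R k (B \<union> C - {b})"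
    proof cases
      case 1
      have "adjoin R k (B \<union> C - {b}) \<subseteq> adjoin R L (B - {b})"
        using L(2) C(1) adjoin_base[of L R "B - {b}"] adjoin_gens[of "B - {b}" R L]
        by (intro adjoin_least) auto
      then show ?thesis using nB[OF 1] by auto
    next
      case 2
      have "adjoin R k (B \<union> C - {b}) \<subseteq> adjoin R K (C - {b})"
        using K(2) B(1) adjoin_base[of K R "C - {b}"] adjoin_gens[of "C - {b}" R K]
        by (intro adjoin_least) auto
      then show ?thesis using nC[OF 2] by auto
    qed
  qed
qed

text \<open>
  At level \<open>n\<close> the union of the \<open>r\<close>-bases of the two root fields generates over \<open>k\<close> the compositum of
  those root fields, and these composita exhaust the compositum of \<open>K\<close> and \<open>L\<close>.
\<close>

lemma di_compositum_ordLeq_csum: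
  "di R p (compositum R K L) k \<le>o di R p K k +c di R p L k"
proof (rule di_ordLeq[OF ground_subfield compositum_subfield compositum_supset(3) Card_order_csum])
  fix B n assume B: "irredundant R k B" "B \<subseteq> root_field R p (compositum R K L) k n"
  have Bc: "B \<subseteq> compositum R K L" using B(2) unfolding root_field_def by auto
  let ?A = "\<lambda>n. root_field R p K k (Suc n) \<union> root_field R p L k (Suc n)"
  let ?C = "\<lambda>n. root_base K k (Suc n) \<union> root_base L k (Suc n)"
  note rK = root_base[OF ground_subfield K] and rL = root_base[OF ground_subfield L]
  show "|B| \<le>o di R p K k +c di R p L k"
  proof (rule irredundant_ordLeq_increasing[OF k _ B(1), of ?A ?C])
    show "B \<subseteq> carrier R" using Bc subfieldE(3)[OF compositum_subfield] by (rule subset_trans)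
    show "incseq ?A"
      using incseq_SucD[OF incseq_root_field[OF ground_subfield K(1)]] incseq_SucD[OF incseq_root_field[OF ground_subfield L(1)]]
      by (intro incseq_SucI Un_mono)
    have "(\<Union>n. ?A n) = K \<union> L"
      using UN_root_field_Suc[OF k K(1)] UN_root_field_Suc[OF k L(1)] by (simp add: UN_Un_distrib)
    then show "B \<subseteq> adjoin R k (\<Union>n. ?A n)"
      using Bc K(2) by (simp add: adjoin_def compositum_def Un_absorb1 flip: Un_assoc)
    fix n
    show CA: "?C n \<subseteq> ?A n" using rK(1) rL(1) by (rule Un_mono)
    have "root_field R p K k (Suc n) \<subseteq> carrier R" "root_field R p L k (Suc n) \<subseteq> carrier R"
      using left_factor_in_carrier right_factor_in_carrier unfolding root_field_def by blast+
    then show "?C n \<subseteq> carrier R" using CA by blast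
    have "adjoin R k (root_base K k (Suc n)) \<subseteq> adjoin R k (?C n)"
      "adjoin R k (root_base L k (Suc n)) \<subseteq> adjoin R k (?C n)"
      by (intro adjoin_mono; simp)+
    then show "?A n \<subseteq> adjoin R k (?C n)" unfolding rK(3) rL(3) by (rule Un_least)
    have "|root_base K k (Suc n)| +c |root_base L k (Suc n)| \<le>o di R p K k +c di R p L k"
      by (intro csum_mono root_base_ordLeq_di) simp_all
    with Un_csum show "|?C n| \<le>o di R p K k +c di R p L k" by (rule ordLeq_transitive)
  qed (rule Card_order_csum)
qed

lemma di_compositum_over_factor_ordLeq:
  "di R p (compositum R K L) L \<le>o di R p K k"
proof (rule di_ordLeq[OF L(1) compositum_subfield compositum_supset(2) Card_order_di])
  fix B n assume B: "irredundant R L B" "B \<subseteq> root_field R p (compositum R K L) L n"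
  have Bc: "B \<subseteq> compositum R K L" using B(2) unfolding root_field_def by auto
  let ?A = "\<lambda>n. root_field R p K k (Suc n)" let ?C = "\<lambda>n. root_base K k (Suc n)"
  note rK = root_base[OF ground_subfield K]
  show "|B| \<le>o di R p K k"
  proof (rule irredundant_ordLeq_increasing[OF purely_inseparable_intermediate[OF k L] _ B(1), of ?A ?C])
    show "B \<subseteq> carrier R" using Bc subfieldE(3)[OF compositum_subfield] by (rule subset_trans)
    show "incseq ?A"
      using incseq_SucD[OF incseq_root_field[OF ground_subfield K(1)]] by (intro incseq_SucI)
    show "B \<subseteq> adjoin R L (\<Union>n. ?A n)"
      unfolding UN_root_field_Suc[OF k K(1)] using Bc by (simp add: adjoin_def compositum_def Un_commute)
    fix n
    show CA: "?C n \<subseteq> ?A n" using rK(1) .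
    have "?A n \<subseteq> carrier R" using left_factor_in_carrier unfolding root_field_def by blast
    then show "?C n \<subseteq> carrier R" using CA by blast
    show "?A n \<subseteq> adjoin R L (?C n)"
      using adjoin_mono[OF L(2) order.refl, of R "?C n"] unfolding rK(3) .
    show "|?C n| \<le>o di R p K k" by (rule root_base_ordLeq_di) simp
  qed (rule Card_order_di)
qed

lemma di_ordLeq_di_compositum_over_factor:
  assumes "linearly_disjoint R k K L"
  shows "di R p K k \<le>o di R p (compositum R K L) L"
proof (rule di_ordLeq[OF ground_subfield K Card_order_di])
  fix B n assume B: "irredundant R k B" "B \<subseteq> root_field R p K k n"
  have BK: "B \<subseteq> K" using B(2) unfolding root_field_def by auto
  have "B \<subseteq> root_field R p (compositum R K L) L n"
    using B(2) compositum_supset(1) L(2) unfolding root_field_def by auto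
  then show "|B| \<le>o di R p (compositum R K L) L"
    using irredundant_over_compositum_factor[OF assms BK B(1)]
      irredundant_ordLeq_di[OF purely_inseparable_intermediate[OF k L] compositum_subfield
        compositum_supset(2)] by blast
qed

text \<open>
  An \<open>r\<close>-base at level \<open>m\<close> in \<open>K\<close> and one at level \<open>n\<close> in \<open>L\<close> combine to an irredundant subset of the
  compositum at level \<open>max m n\<close>.
\<close>

lemma csum_ordLeq_di_compositum:
  assumes ld: "linearly_disjoint R k K L"
  shows "di R p K k +c di R p L k \<le>o di R p (compositum R K L) k"
  unfolding di_eq[of K] di_eq[of L]
proof (rule csum_card_Sup_ordLeq)
  fix s t :: "'a rel"
  assume "s \<in> {|root_base K k n| | n. 1 \<le> n}" "t \<in> {|root_base L k n| | n. 1 \<le> n}"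
  then obtain m n where s: "s = |root_base K k m|" and t: "t = |root_base L k n|" by auto
  let ?B = "root_base K k m" let ?C = "root_base L k n" let ?F = "compositum R K L"
  note rK = root_base[OF ground_subfield K] and rL = root_base[OF ground_subfield L]
  have BC: "?B \<subseteq> K" "?C \<subseteq> L" using rK(1) rL(1) unfolding root_field_def by blast+
  note un = irredundant_Un[OF ld BC(1) rK(2) BC(2) rL(2)]
  have "?B \<subseteq> root_field R p ?F k m" "?C \<subseteq> root_field R p ?F k n"
    using rK(1)[of m] rL(1)[of n] compositum_supset unfolding root_field_def by blast+
  then have "?B \<union> ?C \<subseteq> root_field R p ?F k (max m n)"
    using incseqD[OF incseq_root_field[OF ground_subfield compositum_subfield], of m "max m n"]
      incseqD[OF incseq_root_field[OF ground_subfield compositum_subfield], of n "max m n"] by auto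
  then have "|?B \<union> ?C| \<le>o di R p ?F k"
    using irredundant_ordLeq_di[OF k compositum_subfield compositum_supset(3) un(1)] by blast
  moreover have "|?B| +c |?C| \<le>o |?B \<union> ?C|"
    using card_of_Un_Plus_ordIso[OF un(2)] Plus_csum ordIso_symmetric ordIso_transitive
      ordIso_imp_ordLeq by metis
  ultimately show "s +c t \<le>o di R p ?F k" unfolding s t by (rule ordLeq_transitive[rotated])
qed (auto simp: Card_order_di)

end
end

theorem mainTheorem4:
  fixes \<Omega> :: "('a, 'b) ring_scheme" and p :: nat and k K\<^sub>1 K\<^sub>2 :: "'a set"
  assumes "field \<Omega>"
    and "characteristic \<Omega> = p" and "p > 0"
    and "purely_inseparable \<Omega> p (carrier \<Omega>) k"
    and "subfield K\<^sub>1 \<Omega>" and "k \<subseteq> K\<^sub>1"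
    and "subfield K\<^sub>2 \<Omega>" and "k \<subseteq> K\<^sub>2"
  shows "di \<Omega> p (compositum \<Omega> K\<^sub>1 K\<^sub>2) k \<le>o di \<Omega> p K\<^sub>1 k +c di \<Omega> p K\<^sub>2 k
       \<and> (linearly_disjoint \<Omega> k K\<^sub>1 K\<^sub>2 \<longrightarrow>
            di \<Omega> p (compositum \<Omega> K\<^sub>1 K\<^sub>2) k =o di \<Omega> p K\<^sub>1 k +c di \<Omega> p K\<^sub>2 k)
       \<and> di \<Omega> p (compositum \<Omega> K\<^sub>1 K\<^sub>2) K\<^sub>2 \<le>o di \<Omega> p K\<^sub>1 k
       \<and> (linearly_disjoint \<Omega> k K\<^sub>1 K\<^sub>2 \<longrightarrow>
            di \<Omega> p (compositum \<Omega> K\<^sub>1 K\<^sub>2) K\<^sub>2 =o di \<Omega> p K\<^sub>1 k)"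
proof -
  interpret field \<Omega> by (rule assms(1))
  interpret char_p_field \<Omega> p
    using prime_characteristic[OF assms(2,3)] by unfold_locales
  note h = assms(4-8)
  show ?thesis
    using di_compositum_ordLeq_csum[OF h] csum_ordLeq_di_compositum[OF h]
      di_compositum_over_factor_ordLeq[OF h] di_ordLeq_di_compositum_over_factor[OF h]
    by (simp add: ordIso_iff_ordLeq)
qed

end
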